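(* Let $\{\lambda_n\}_{n=0}^\infty$ be a non-trivial sequence of non-negative real numbers. Then $\{\lambda_n\}$ is a Hermite multiplier sequence if and only if it is a (classical) multiplier sequence and $\lambda_n\le\lambda_{n+1}$ for all $n\ge0$.
   Context: The Hermite polynomials $H_n(x)$ are defined by $\exp(2xt-t^2)=\sum_{n\ge0}\frac{H_n(x)}{n!}t^n$. A real sequence $\{\lambda_n\}$ is a Hermite multiplier sequence if the linear operator $T$ on $\mathbb{R}[x]$ with $T(H_n)=\lambda_nH_n$ for all $n$ maps real-rooted polynomials to real-rooted polynomials (constants count as real-rooted); it is a (classical) multiplier sequence if $x^n\mapsto\lambda_nx^n$ has this property. A sequence is trivial if there is $k\in\mathbb{N}$ with $\lambda_n=0$ for all $n\notin\{k,k+1\}$, non-trivial otherwise. *)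

theory Defs
  imports "HOL-Computational_Algebra.Polynomial" Complex_Main
begin

text \<open>Physicists' Hermite polynomials, generating function exp(2xt - t^2):
  H_0 = 1, H_1 = 2x, H_(n+2) = 2x H_(n+1) - 2(n+1) H_n.\<close>
fun hermite :: "nat \<Rightarrow> real poly" where
  "hermite 0 = 1"
| "hermite (Suc 0) = [:0, 2:]"
| "hermite (Suc (Suc n)) = [:0, 2:] * hermite (Suc n) - smult (2 * real (Suc n)) (hermite n)"

definition real_rooted :: "real poly \<Rightarrow> bool" where
  "real_rooted p \<longleftrightarrow> degree p = 0 \<or>
     (\<forall>z::complex. poly (map_poly complex_of_real p) z = 0 \<longrightarrow> Im z = 0)"

definition classical_op :: "(nat \<Rightarrow> real) \<Rightarrow> real poly \<Rightarrow> real poly" where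
  "classical_op lam p = (\<Sum>k\<le>degree p. monom (lam k * coeff p k) k)"

definition hermite_op :: "(nat \<Rightarrow> real) \<Rightarrow> real poly \<Rightarrow> real poly" where
  "hermite_op lam p = (THE q. \<exists>c. p = (\<Sum>k\<le>degree p. smult (c k) (hermite k)) \<and>
                                 q = (\<Sum>k\<le>degree p. smult (lam k * c k) (hermite k)))"

definition multiplier_sequence :: "(nat \<Rightarrow> real) \<Rightarrow> bool" where
  "multiplier_sequence lam \<longleftrightarrow> (\<forall>p. real_rooted p \<longrightarrow> real_rooted (classical_op lam p))"

definition hermite_multiplier_sequence :: "(nat \<Rightarrow> real) \<Rightarrow> bool" where
  "hermite_multiplier_sequence lam \<longleftrightarrow> (\<forall>p. real_rooted p \<longrightarrow> real_rooted (hermite_op lam p))"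

definition trivial_sequence :: "(nat \<Rightarrow> real) \<Rightarrow> bool" where
  "trivial_sequence lam \<longleftrightarrow> (\<exists>k. \<forall>n. n \<noteq> k \<and> n \<noteq> Suc k \<longrightarrow> lam n = 0)"

end

theory Submission
  imports Defs "HOL-Computational_Algebra.Fundamental_Theorem_Algebra"
begin

text \<open>
  With \<open>A = x - D/2\<close>, the operator \<open>hermite n \<mapsto> lam n * hermite n\<close> equals
  \<open>\<Sum>k. F k A^k D^k\<close>, where \<open>F k\<close> is the \<open>k\<close>-th forward difference of \<open>lam\<close> at \<open>0\<close> divided by \<open>k!\<close>.

  Sufficiency. All Jensen polynomials of a multiplier sequence are real-rooted. If the sequence is
  also nonnegative and nondecreasing, Turan-type inequalities force its differences to be
  nondecreasing as well, so all forward differences are nonnegative and \<open>\<Sum>k. F k z^k\<close> is a limit of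
  real-rooted polynomials with nonnegative coefficients, that is, of products of factors \<open>z + s\<close> with
  \<open>s \<ge> 0\<close>. In two variables, with \<open>A = x - \<partial>\<^sub>x/2 - \<partial>\<^sub>y/2\<close> and \<open>B = \<partial>\<^sub>y\<close> (which commute), each factor
  \<open>s + A B\<close> preserves the absence of zeros with both variables in the upper half plane; apply the
  product to \<open>f(y)\<close> and set \<open>y = x\<close>.

  Necessity. Rescaling \<open>x\<close> turns Hermite polynomials into monomials in the limit. If \<open>lam\<close> ever
  decreases, then by log-concavity it keeps decreasing or is eventually zero. In either case, applying
  the operator to \<open>2x hermite (n + 1)\<close> or to \<open>(x\<^sup>2 - s) hermite (n + 2)\<close> gives a multiple of
  \<open>hermite (n + 2) + c hermite n\<close> with \<open>c\<close> so large that there is a root on the imaginary axis.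
\<close>

section \<open>Real-rooted polynomials\<close>

abbreviation cpoly :: "real poly \<Rightarrow> complex poly" where
  "cpoly p \<equiv> map_poly complex_of_real p"

lemma coeff_cpoly [simp]: "coeff (cpoly p) n = complex_of_real (coeff p n)"
  by (simp add: coeff_map_poly)

lemma degree_cpoly [simp]: "degree (cpoly p) = degree p"
  by (simp add: degree_map_poly)

lemma cpoly_eq_0_iff [simp]: "cpoly p = 0 \<longleftrightarrow> p = 0"
  by (simp add: map_poly_eq_0_iff)

lemma cpoly_add [simp]: "cpoly (p + q) = cpoly p + cpoly q"
  by (intro poly_eqI) simp

lemma cpoly_diff [simp]: "cpoly (p - q) = cpoly p - cpoly q"
  by (intro poly_eqI) simp

lemma cpoly_smult [simp]: "cpoly (smult c p) = smult (complex_of_real c) (cpoly p)"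
  by (intro poly_eqI) simp

lemma cpoly_pCons [simp]: "cpoly (pCons c p) = pCons (complex_of_real c) (cpoly p)"
  by (simp add: map_poly_pCons)

lemma cpoly_mult [simp]: "cpoly (p * q) = cpoly p * cpoly q"
  by (intro poly_eqI) (simp add: coeff_mult)

lemma cpoly_pderiv [simp]: "cpoly (pderiv p) = pderiv (cpoly p)"
  by (intro poly_eqI) (simp add: coeff_pderiv)

lemma cpoly_sum [simp]: "cpoly (sum f A) = (\<Sum>x\<in>A. cpoly (f x))"
  by (induction A rule: infinite_finite_induct) auto

lemma cpoly_pcompose [simp]: "cpoly (pcompose p q) = pcompose (cpoly p) (cpoly q)"
  by (induction p) (auto simp: pcompose_pCons)

lemma poly_cpoly_of_real [simp]: "poly (cpoly p) (of_real x) = of_real (poly p x)"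
  by (induction p) auto

lemma poly_cpoly_cnj: "poly (cpoly p) (cnj z) = cnj (poly (cpoly p) z)"
  by (induction p) auto

text \<open>Nonreal roots of a real polynomial come in conjugate pairs, so one open half plane
  decides. The zero polynomial is split off because every constant counts as real-rooted.\<close>

lemma real_rooted_iff_upper_half_plane:
  "real_rooted p \<longleftrightarrow> p = 0 \<or> (\<forall>z. Im z > 0 \<longrightarrow> poly (cpoly p) z \<noteq> 0)"
proof
  assume "real_rooted p"
  then consider "degree p = 0" | "\<forall>z. poly (cpoly p) z = 0 \<longrightarrow> Im z = 0"
    by (auto simp: real_rooted_def)
  then show "p = 0 \<or> (\<forall>z. Im z > 0 \<longrightarrow> poly (cpoly p) z \<noteq> 0)"
  proof cases
    case 1
    then obtain c where "p = [:c:]" using degree_eq_zeroE by blast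
    then show ?thesis by auto
  next
    case 2
    then show ?thesis by fastforce
  qed
next
  assume "p = 0 \<or> (\<forall>z. Im z > 0 \<longrightarrow> poly (cpoly p) z \<noteq> 0)"
  moreover have "Im z = 0" if *: "\<forall>z. Im z > 0 \<longrightarrow> poly (cpoly p) z \<noteq> 0" and z: "poly (cpoly p) z = 0" for z
  proof -
    have "poly (cpoly p) (cnj z) = 0" using z by (simp add: poly_cpoly_cnj)
    then have "\<not> Im (cnj z) > 0" "\<not> Im z > 0" using * z by blast+
    then show ?thesis by simp
  qed
  ultimately show "real_rooted p" unfolding real_rooted_def by fastforce
qed

lemma real_rooted_0 [simp]: "real_rooted 0"
  by (simp add: real_rooted_iff_upper_half_plane)

lemma real_rooted_imp_Im_eq_0:
  assumes "real_rooted p" "p \<noteq> 0" "poly (cpoly p) z = 0"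
  shows "Im z = 0"
proof -
  have "poly (cpoly p) (cnj z) = 0" using assms by (simp add: poly_cpoly_cnj)
  then have "\<not> Im (cnj z) > 0" "\<not> Im z > 0"
    using assms unfolding real_rooted_iff_upper_half_plane by blast+
  then show ?thesis by simp
qed

lemma real_rooted_mult:
  assumes "real_rooted p" "real_rooted q"
  shows "real_rooted (p * q)"
  using assms by (auto simp: real_rooted_iff_upper_half_plane)

lemma real_rooted_linear: "real_rooted [:a, b:]"
proof (cases "b = 0")
  case False
  then show ?thesis
    by (auto simp: real_rooted_iff_upper_half_plane complex_eq_iff)
qed (simp add: real_rooted_def)

lemma real_rooted_smult:
  assumes "real_rooted p"
  shows "real_rooted (smult c p)"
  using assms by (auto simp: real_rooted_iff_upper_half_plane)

lemma real_rooted_smult_iff [simp]: "c \<noteq> 0 \<Longrightarrow> real_rooted (smult c p) \<longleftrightarrow> real_rooted p"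
  by (auto simp: real_rooted_iff_upper_half_plane)

lemma real_rooted_scale:
  assumes "real_rooted p"
  shows "real_rooted (pcompose p [:0, c:])"
proof (cases "c = 0 \<or> p = 0")
  case True
  then show ?thesis by (auto simp: pcompose_0' real_rooted_def)
next
  case False
  have "poly (cpoly (pcompose p [:0, c:])) z \<noteq> 0" if "Im z > 0" for z
    using real_rooted_imp_Im_eq_0[OF assms, of "z * of_real c"] that False
    by (auto simp: poly_pcompose)
  then show ?thesis by (simp add: real_rooted_iff_upper_half_plane)
qed

text \<open>Splits off one root at a time by the fundamental theorem of algebra; \<open>S\<close>
  records where the roots lie, so that bounds on logarithmic derivatives can be proved factor by
  factor.\<close>

lemma complex_poly_root_induct [consumes 2, case_names const mult]:
  fixes P :: "complex poly"
  assumes "P \<noteq> 0" and "\<forall>z. poly P z = 0 \<longrightarrow> S z"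
    and const: "\<And>c. c \<noteq> 0 \<Longrightarrow> R [:c:]"
    and mult: "\<And>a Q. Q \<noteq> 0 \<Longrightarrow> S a \<Longrightarrow> R Q \<Longrightarrow> R ([:-a, 1:] * Q)"
  shows "R P"
  using assms(1,2)
proof (induction "degree P" arbitrary: P)
  case 0
  then obtain c where "P = [:c:]" by (metis degree_eq_zeroE)
  then show ?case using 0 const by simp
next
  case (Suc n)
  have "\<not> constant (poly P)" using Suc.hyps(2) by (simp add: constant_degree)
  then obtain a where a: "poly P a = 0" using fundamental_theorem_of_algebra by blast
  then obtain Q where Q: "P = [:-a, 1:] * Q" by (metis poly_eq_0_iff_dvd dvdE)
  have "Q \<noteq> 0" using Q Suc.prems by auto
  moreover have "degree P = Suc (degree Q)"
    unfolding Q using \<open>Q \<noteq> 0\<close> by (subst degree_mult_eq) auto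
  moreover have S: "S z" if "poly Q z = 0" for z
    using Suc.prems(2) that unfolding Q by simp
  ultimately have "R Q" using Suc.hyps(1)[of Q] Suc.hyps(2) by simp
  then show ?case unfolding Q using mult[OF \<open>Q \<noteq> 0\<close>] Suc.prems(2) a by blast
qed

section \<open>Logarithmic derivatives in the upper half plane\<close>

lemma Im_inverse_neg: "Im (w::complex) > 0 \<Longrightarrow> Im (1 / w) < 0"
  by (simp add: Im_divide divide_neg_pos sum_power2_gt_zero_iff)

text \<open>\<open>P'/P\<close> is the sum of \<open>1 / (z - a)\<close> over the roots
  \<open>a\<close>, and each term has negative imaginary part because \<open>a\<close> is not in the
  upper half plane. Strictness requires at least one root.\<close>

lemma log_deriv_upper_half_plane:
  fixes P :: "complex poly"
  assumes "\<And>z. Im z > 0 \<Longrightarrow> poly P z \<noteq> 0" and z: "Im z > 0"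
  obtains l where "poly (pderiv P) z = l * poly P z" "Im l \<le> 0" "degree P > 0 \<Longrightarrow> Im l < 0"
proof -
  have "P \<noteq> 0" using assms by auto
  moreover have "\<forall>w. poly P w = 0 \<longrightarrow> Im w \<le> 0"
    using assms(1) not_le by blast
  ultimately have "\<exists>l. poly (pderiv P) z = l * poly P z \<and> Im l \<le> 0 \<and> (degree P > 0 \<longrightarrow> Im l < 0)"
  proof (induction P rule: complex_poly_root_induct)
    case (const c)
    show ?case by (rule exI[of _ 0]) simp
  next
    case (mult a Q)
    then obtain l where l: "poly (pderiv Q) z = l * poly Q z" "Im l \<le> 0" by auto
    have za: "Im (z - a) > 0" using mult z by simp
    then have "z - a \<noteq> 0" by auto
    then have "poly (pderiv ([:-a, 1:] * Q)) z = (l + 1 / (z - a)) * poly ([:-a, 1:] * Q) z"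
      unfolding pderiv_mult poly_add poly_mult l(1) by (simp add: pderiv_pCons field_simps)
    moreover have "Im (l + 1 / (z - a)) < 0" using l Im_inverse_neg[OF za] by simp
    ultimately show ?case by (intro exI[of _ "l + 1 / (z - a)"]) simp
  qed
  then obtain l where l: "poly (pderiv P) z = l * poly P z" "Im l \<le> 0" "degree P > 0 \<longrightarrow> Im l < 0"
    by (elim exE conjE) (rule that)
  show thesis by (rule that[OF l(1,2)]) (use l(3) in simp)
qed

text \<open>A real root \<open>b\<close> contributes \<open>(z - a)^2 / (z - b) = (z - b) + 2 (b -
  a) + (b - a)^2 / (z - b)\<close>, whose imaginary part is at most \<open>Im z\<close>.\<close>

lemma log_deriv_polar:
  fixes P :: "complex poly"
  assumes "P \<noteq> 0" "\<forall>w. poly P w = 0 \<longrightarrow> Im w = 0" and z: "Im z > 0"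
  obtains l where "poly (pderiv P) z = l * poly P z"
    "\<And>a. Im ((z - of_real a)\<^sup>2 * l) \<le> degree P * Im z"
proof -
  have "\<exists>l. poly (pderiv P) z = l * poly P z \<and> (\<forall>a. Im ((z - of_real a)\<^sup>2 * l) \<le> degree P * Im z)"
    using assms(1,2)
  proof (induction P rule: complex_poly_root_induct)
    case (const c)
    show ?case by (rule exI[of _ 0]) simp
  next
    case (mult b Q)
    then obtain l where l: "poly (pderiv Q) z = l * poly Q z"
      "\<And>a. Im ((z - of_real a)\<^sup>2 * l) \<le> degree Q * Im z" by auto
    have zb: "Im (z - b) > 0" using mult z by simp
    then have nz: "z - b \<noteq> 0" by auto
    then have "poly (pderiv ([:-b, 1:] * Q)) z = (l + 1 / (z - b)) * poly ([:-b, 1:] * Q) z"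
      unfolding pderiv_mult poly_add poly_mult l(1) by (simp add: pderiv_pCons field_simps)
    moreover have "Im ((z - of_real a)\<^sup>2 * (l + 1 / (z - b))) \<le> degree ([:-b, 1:] * Q) * Im z" for a
    proof -
      have b: "b = of_real (Re b)" using mult by (simp add: complex_eq_iff)
      have "(z - of_real a)\<^sup>2 * (1 / (z - b))
            = (z - b) + 2 * (b - of_real a) + (b - of_real a)\<^sup>2 * (1 / (z - b))"
        using nz by (simp add: field_simps power2_eq_square)
      also have "\<dots> = (z - b) + of_real (2 * (Re b - a)) + of_real ((Re b - a)\<^sup>2) * (1 / (z - b))"
        by (subst (2 3) b) simp
      finally have "Im ((z - of_real a)\<^sup>2 * (1 / (z - b))) = Im z + (Re b - a)\<^sup>2 * Im (1 / (z - b))"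
        using mult(2) by (simp only: plus_complex.sel minus_complex.sel Im_complex_of_real
            times_complex.sel Re_complex_of_real)
      also have "\<dots> \<le> Im z"
        using Im_inverse_neg[OF zb] by (simp add: mult_nonneg_nonpos)
      finally have "Im ((z - of_real a)\<^sup>2 * (l + 1 / (z - b))) \<le> degree Q * Im z + Im z"
        using l(2)[of a] unfolding distrib_left plus_complex.sel by linarith
      also have "\<dots> = degree ([:-b, 1:] * Q) * Im z"
        using mult(1) by (subst degree_mult_eq) (auto simp: algebra_simps)
      finally show ?thesis .
    qed
    ultimately show ?case by blast
  qed
  then obtain l where l: "poly (pderiv P) z = l * poly P z"
    "\<forall>a. Im ((z - of_real a)\<^sup>2 * l) \<le> degree P * Im z"
    by (elim exE conjE) (rule that)
  show thesis by (rule that[OF l(1) l(2)[rule_format]])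
qed

text \<open>The distance to each real root grows as \<open>z\<close> moves up a vertical ray from
  the real axis.\<close>

lemma norm_poly_vertical_mono:
  fixes P :: "complex poly"
  assumes "P \<noteq> 0" "\<forall>w. poly P w = 0 \<longrightarrow> Im w = 0" "0 \<le> y" "y \<le> y'"
  shows "norm (poly P (Complex x y)) \<le> norm (poly P (Complex x y'))"
  using assms(1,2)
proof (induction P rule: complex_poly_root_induct)
  case (mult a Q)
  have "y\<^sup>2 \<le> y'\<^sup>2" using assms by (simp add: power_mono)
  then have "norm (Complex x y - a) \<le> norm (Complex x y' - a)"
    using mult by (simp add: cmod_def)
  then show ?case
    using mult.IH unfolding poly_mult norm_mult by (intro mult_mono) auto
qed simp

text \<open>Monotonicity of the modulus along vertical rays characterises real-rootedness and,
  unlike the location of the roots, is visibly stable under limits in which the degree may drop.\<close>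

lemma real_rooted_iff_vertical_mono:
  "real_rooted p \<longleftrightarrow> (\<forall>x y y'. 0 \<le> y \<longrightarrow> y \<le> y' \<longrightarrow>
     norm (poly (cpoly p) (Complex x y)) \<le> norm (poly (cpoly p) (Complex x y')))"
    (is "_ \<longleftrightarrow> ?mono")
proof
  assume "real_rooted p"
  then show ?mono
    using norm_poly_vertical_mono[of "cpoly p"] real_rooted_imp_Im_eq_0[of p]
    by (cases "p = 0") auto
next
  assume mono: ?mono
  have "poly (cpoly p) z \<noteq> 0" if "Im z > 0" "p \<noteq> 0" for z
  proof
    assume z: "poly (cpoly p) z = 0"
    \<comment> \<open>Monotonicity spreads a zero to the whole vertical segment below it, giving
      infinitely many zeros.\<close>
    have "Complex (Re z) ` {0..Im z} \<subseteq> {w. poly (cpoly p) w = 0}"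
      using mono[rule_format, of _ "Im z" "Re z"] z by auto
    moreover have "infinite (Complex (Re z) ` {0..Im z})"
      using that by (subst finite_image_iff) (auto simp: inj_on_def infinite_Icc)
    ultimately show False
      using poly_roots_finite[of "cpoly p"] that by (auto dest: finite_subset)
  qed
  then show "real_rooted p" by (auto simp: real_rooted_iff_upper_half_plane)
qed

text \<open>A Hurwitz-type principle that also covers limits that vanish or lose degree. The common
  bound \<open>N\<close> turns convergence of coefficients into pointwise convergence.\<close>

lemma real_rooted_limit:
  assumes F: "F \<noteq> bot" and rr: "\<forall>\<^sub>F n in F. real_rooted (p n)"
    and deg: "\<And>n. degree (p n) \<le> N"
    and lim: "\<And>k. ((\<lambda>n. coeff (p n) k) \<longlongrightarrow> coeff q k) F"
  shows "real_rooted q"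
proof -
  have eval: "poly (cpoly r) z = (\<Sum>i\<le>M. of_real (coeff r i) * z ^ i)" if "degree r \<le> M" for r z M
    using that unfolding poly_altdef
    by (intro sum.mono_neutral_cong_left) (auto simp: coeff_eq_0)
  have degq: "degree q \<le> N"
  proof (rule degree_le, intro allI impI)
    fix i assume "N < i"
    then have "coeff (p n) i = 0" for n using deg[of n] by (intro coeff_eq_0) linarith
    then show "coeff q i = 0" using lim[of i] F by (simp add: tendsto_const_iff)
  qed
  have conv: "((\<lambda>n. norm (poly (cpoly (p n)) z)) \<longlongrightarrow> norm (poly (cpoly q) z)) F" for z
    unfolding eval[OF deg] eval[OF degq]
    by (intro tendsto_norm tendsto_sum tendsto_mult tendsto_of_real lim tendsto_const)
  show ?thesis unfolding real_rooted_iff_vertical_mono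
  proof (intro allI impI)
    fix x y y' :: real assume "0 \<le> y" "y \<le> y'"
    then show "norm (poly (cpoly q) (Complex x y)) \<le> norm (poly (cpoly q) (Complex x y'))"
      using rr by (intro tendsto_le[OF F conv conv])
        (auto elim!: eventually_mono simp: real_rooted_iff_vertical_mono)
  qed
qed

lemma real_rooted_pderiv:
  assumes "real_rooted p"
  shows "real_rooted (pderiv p)"
proof (cases "degree p = 0")
  case True
  then have "pderiv p = 0" by (simp add: pderiv_eq_0_iff)
  then show ?thesis by simp
next
  case False
  then have p: "p \<noteq> 0" by auto
  have nz: "poly (cpoly p) z \<noteq> 0" if "Im z > 0" for z
    using assms p that by (auto simp: real_rooted_iff_upper_half_plane)
  have "poly (cpoly (pderiv p)) z \<noteq> 0" if z: "Im z > 0" for z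
    using log_deriv_upper_half_plane[of "cpoly p" z, OF nz z] False nz[OF z]
    by (metis cpoly_pderiv degree_cpoly less_irrefl mult_eq_0_iff neq0_conv zero_complex.sel(2))
  then show ?thesis by (simp add: real_rooted_iff_upper_half_plane)
qed

text \<open>Laguerre: the polar derivative with respect to the real point \<open>-1/t\<close>. For \<open>N > degree p\<close>
  the imaginary part of the logarithmic derivative rules out zeros in the upper half plane; the
  case \<open>N = degree p\<close> follows by letting \<open>N\<close> decrease to the degree.\<close>

lemma real_rooted_polar:
  assumes rr: "real_rooted p" and N: "real (degree p) \<le> N"
  shows "real_rooted ([:1, t:] * pderiv p - smult (t * N) p)"
proof (cases "t = 0 \<or> p = 0")
  case True
  then show ?thesis using real_rooted_pderiv[OF rr] by auto
next
  case False
  define q where "q M = [:1, t:] * pderiv p - smult (t * M) p" for M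
  have strict: "real_rooted (q M)" if M: "real (degree p) < M" for M
  proof -
    have "poly (cpoly (q M)) z \<noteq> 0" if z: "Im z > 0" for z
    proof
      assume *: "poly (cpoly (q M)) z = 0"
      have nz: "poly (cpoly p) z \<noteq> 0"
        using rr False z by (auto simp: real_rooted_iff_upper_half_plane)
      obtain l where l: "poly (pderiv (cpoly p)) z = l * poly (cpoly p) z"
        "\<And>a. Im ((z - of_real a)\<^sup>2 * l) \<le> degree p * Im z"
        using log_deriv_polar[of "cpoly p" z] real_rooted_imp_Im_eq_0[OF rr] False z by auto
      have "((1 + of_real t * z) * l - of_real (t * M)) * poly (cpoly p) z = 0"
        using * l(1) by (simp add: q_def algebra_simps)
      then have "(1 + of_real t * z) * l = of_real t * of_real M"
        using nz by simp
      moreover have "1 + of_real t * z = of_real t * (z - of_real (- 1 / t))"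
        using False by (simp add: field_simps)
      ultimately have "of_real t * ((z - of_real (- 1 / t)) * l) = of_real t * of_real M"
        by (simp only: mult.assoc)
      then have "(z - of_real (- 1 / t)) * l = of_real M" using False by simp
      \<comment> \<open>A second factor \<open>z - a\<close> with \<open>a = -1/t\<close> brings the
        equation into the form bounded by \<open>log_deriv_polar\<close>; it would force
        \<open>M <= degree p\<close>.\<close>
      then have "(z - of_real (- 1 / t))\<^sup>2 * l = (z - of_real (- 1 / t)) * of_real M"
        by (simp add: power2_eq_square)
      then have "Im ((z - of_real (- 1 / t))\<^sup>2 * l) = M * Im z" by (simp only:) simp
      then have "M * Im z \<le> degree p * Im z" using l(2)[of "- 1 / t"] by simp
      then show False using M z by simp
    qed
    then show ?thesis by (simp add: real_rooted_iff_upper_half_plane)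
  qed
  have "degree (q M) \<le> Suc (degree p)" for M
  proof -
    have "degree ([:1, t:] * pderiv p) \<le> Suc (degree p)"
      by (rule order_trans[OF degree_mult_le]) (auto simp: degree_pderiv)
    then show ?thesis unfolding q_def
      by (intro degree_diff_le) (auto intro: order_trans[OF degree_smult_le])
  qed
  moreover have "((\<lambda>M. coeff (q M) k) \<longlongrightarrow> coeff (q N) k) (at_right N)" for k
    unfolding q_def coeff_diff coeff_smult by (intro tendsto_intros)
  moreover have "\<forall>\<^sub>F M in at_right N. real_rooted (q M)"
    using N strict by (auto intro!: eventually_at_rightI[of N "N + 1"])
  ultimately have "real_rooted (q N)"
    by (intro real_rooted_limit[of "at_right N" q]) (auto simp: trivial_limit_at_right_real)
  then show ?thesis by (simp add: q_def)
qed

lemma real_rooted_quadratic: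
  assumes "real_rooted [:a, 2 * b, c:]"
  shows "a * c \<le> b\<^sup>2"
proof (rule ccontr)
  assume neg: "\<not> a * c \<le> b\<^sup>2"
  then have c: "c \<noteq> 0" by (auto simp: not_le)
  define s where "s = sqrt (a * c - b\<^sup>2)"
  have s: "s\<^sup>2 = a * c - b\<^sup>2" "s \<noteq> 0" using neg by (auto simp: s_def)
  define z where "z = Complex (- b / c) (s / c)"
  have "poly (cpoly [:a, 2 * b, c:]) z = 0"
  proof -
    have "b * b + s * s = a * c" using s(1) by (simp add: power2_eq_square)
    then have "(b * b + s * s) * (c * c) = a * c * (c * c)" by simp
    then show ?thesis
      using c by (simp add: z_def complex_eq_iff field_simps)
  qed
  then have "Im z = 0" using assms c by (intro real_rooted_imp_Im_eq_0) auto
  then show False using s c by (simp add: z_def)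
qed

section \<open>Hermite expansions\<close>

lemma pderiv_hermite_Suc: "pderiv (hermite (Suc n)) = smult (2 * real (Suc n)) (hermite n)"
proof (induction n rule: less_induct)
  case (less n)
  show ?case
  proof (cases n)
    case 0
    then show ?thesis by (simp add: pderiv_pCons one_pCons)
  next
    case (Suc m)
    have m: "pderiv (hermite (Suc m)) = smult (2 * real (Suc m)) (hermite m)"
      using less Suc by blast
    \<comment> \<open>By the induction hypothesis the derivative is exactly the subtracted term of
      the three-term recurrence.\<close>
    have rec: "[:0, 2:] * hermite m - pderiv (hermite m) = hermite (Suc m)"
    proof (cases m)
      case (Suc j)
      then show ?thesis using less[of j] \<open>n = Suc m\<close> by simp
    qed simp
    have "pderiv (hermite (Suc (Suc m)))
        = smult 2 (hermite (Suc m))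
          + smult (2 * real (Suc m)) ([:0, 2:] * hermite m - pderiv (hermite m))"
      unfolding hermite.simps pderiv_diff pderiv_mult pderiv_smult m
      by (simp add: pderiv_pCons smult_diff_right algebra_simps)
    also have "\<dots> = smult (2 * real (Suc (Suc m))) (hermite (Suc m))"
      unfolding rec by (simp add: smult_add_left [symmetric])
    finally show ?thesis unfolding Suc .
  qed
qed

text \<open>Conjugating multiplication by \<open>x\<close> with the heat semigroup gives \<open>x - D/2\<close>, which raises
  the index of a Hermite polynomial by one (up to the factor 2).\<close>

definition raising :: "'a::field_char_0 poly \<Rightarrow> 'a poly" where
  "raising p = pCons 0 p - smult (1/2) (pderiv p)"

lemma raising_add: "raising (p + q) = raising p + raising q"
  by (simp add: raising_def pderiv_add smult_add_right)

lemma raising_smult: "raising (smult c p) = smult c (raising p)"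
  by (simp add: raising_def pderiv_smult smult_diff_right)

lemma raising_0 [simp]: "raising 0 = 0"
  by (simp add: raising_def)

lemma raising_pow_add: "(raising ^^ k) (p + q) = (raising ^^ k) p + (raising ^^ k) q"
  by (induction k) (simp_all add: raising_add)

lemma raising_pow_smult: "(raising ^^ k) (smult c p) = smult c ((raising ^^ k) p)"
  by (induction k) (simp_all add: raising_smult)

lemma cpoly_raising: "cpoly (raising p) = raising (cpoly p)"
  by (simp add: raising_def)

lemma raising_hermite: "raising (hermite n) = smult (1/2) (hermite (Suc n))"
proof (cases n)
  case 0
  then show ?thesis by (simp add: raising_def one_pCons)
next
  case (Suc m)
  have "raising (hermite (Suc m)) = pCons 0 (hermite (Suc m)) - smult (real (Suc m)) (hermite m)"
    unfolding raising_def pderiv_hermite_Suc smult_smult mult.assoc[symmetric] by simp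
  also have "\<dots> = smult (1/2) (hermite (Suc (Suc m)))"
    unfolding hermite.simps smult_diff_right smult_smult mult.assoc[symmetric] by simp
  finally show ?thesis unfolding Suc .
qed

text \<open>At a point \<open>z\<close> of the upper half plane the operator multiplies
  \<open>p\<close> by \<open>z - l / 2\<close>, where \<open>l\<close> is the logarithmic
  derivative; this factor again lies in the upper half plane.\<close>

lemma raising_real_rooted:
  assumes "real_rooted p"
  shows "real_rooted (raising p)"
proof (cases "p = 0")
  case False
  have nz: "poly (cpoly p) z \<noteq> 0" if "Im z > 0" for z
    using assms False that by (auto simp: real_rooted_iff_upper_half_plane)
  have "poly (cpoly (raising p)) z \<noteq> 0" if z: "Im z > 0" for z
  proof -
    obtain l where l: "poly (pderiv (cpoly p)) z = l * poly (cpoly p) z" "Im l \<le> 0"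
      using log_deriv_upper_half_plane[of "cpoly p" z, OF nz z] by blast
    have "poly (cpoly (raising p)) z = (z - l / 2) * poly (cpoly p) z"
      using l(1) by (simp add: raising_def algebra_simps)
    moreover have "Im (z - l / 2) > 0" using l(2) z by simp
    then have "z - l / 2 \<noteq> 0" by auto
    ultimately show ?thesis using nz[OF z] by simp
  qed
  then show ?thesis by (simp add: real_rooted_iff_upper_half_plane)
qed simp

lemma real_rooted_hermite: "real_rooted (hermite n)"
proof (induction n)
  case 0
  then show ?case by (simp add: real_rooted_def)
next
  case (Suc n)
  then show ?case using raising_real_rooted[OF Suc] by (simp add: raising_hermite)
qed

section \<open>Expansion in the Hermite basis\<close>

lemma degree_hermite_le: "degree (hermite n) \<le> n"
  and coeff_hermite_self: "coeff (hermite n) n = 2 ^ n"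
proof -
  have "degree (hermite n) \<le> n \<and> coeff (hermite n) n = 2 ^ n"
  proof (induction n)
    case (Suc n)
    have eq: "hermite (Suc n) = smult 2 (raising (hermite n))" by (simp add: raising_hermite)
    have "coeff (hermite n) (Suc k) = 0" if "k \<ge> n" for k
      using Suc that by (intro coeff_eq_0) linarith
    then show ?case unfolding eq using Suc
      by (auto simp: raising_def coeff_pderiv coeff_pCons coeff_eq_0 intro!: degree_le split: nat.splits)
  qed auto
  then show "degree (hermite n) \<le> n" "coeff (hermite n) n = 2 ^ n" by auto
qed

text \<open>The upper index may exceed the degree, so that several polynomials can share one
  expansion length.\<close>

definition hermite_sum :: "nat \<Rightarrow> (nat \<Rightarrow> real) \<Rightarrow> real poly" where
  "hermite_sum n c = (\<Sum>k\<le>n. smult (c k) (hermite k))"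

lemma degree_hermite_sum_le: "degree (hermite_sum n c) \<le> n"
  unfolding hermite_sum_def
  by (intro degree_sum_le order_trans[OF degree_smult_le] order_trans[OF degree_hermite_le]) auto

lemma coeff_hermite_sum_self: "coeff (hermite_sum n c) n = 2 ^ n * c n"
proof (cases n)
  case (Suc m)
  have "coeff (hermite_sum m c) (Suc m) = 0"
    using degree_hermite_sum_le[of m c] by (intro coeff_eq_0) linarith
  then show ?thesis by (simp add: Suc hermite_sum_def coeff_hermite_self del: hermite.simps)
qed (simp add: hermite_sum_def)

lemma hermite_expansion:
  assumes "degree p \<le> n"
  obtains c where "p = hermite_sum n c"
proof -
  have "\<exists>c. p = hermite_sum n c" using assms
  proof (induction n arbitrary: p)
    case 0
    then obtain a where "p = [:a:]" by (metis degree_eq_zeroE le_zero_eq)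
    then show ?case by (intro exI[of _ "\<lambda>_. a"]) (simp add: hermite_sum_def)
  next
    case (Suc n)
    define a where "a = coeff p (Suc n) / 2 ^ Suc n"
    define q where "q = p - smult a (hermite (Suc n))"
    have "degree q \<le> n"
    proof (rule degree_le, intro allI impI)
      fix i assume "n < i"
      then consider "i = Suc n" | "i > Suc n" by linarith
      then show "coeff q i = 0"
        using Suc.prems degree_hermite_le[of "Suc n"] coeff_hermite_self[of "Suc n"]
        by cases (auto simp: q_def a_def coeff_eq_0 simp del: hermite.simps)
    qed
    then obtain c where c: "q = hermite_sum n c" using Suc.IH by blast
    have "hermite_sum (Suc n) (c(Suc n := a)) = q + smult a (hermite (Suc n))"
      by (simp add: c hermite_sum_def del: hermite.simps)
    then have "p = hermite_sum (Suc n) (c(Suc n := a))" by (simp only: q_def diff_add_cancel)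
    then show ?case by blast
  qed
  then show thesis using that by blast
qed

lemma hermite_sum_inject:
  assumes "hermite_sum n c = hermite_sum n d" "k \<le> n"
  shows "c k = d k"
  using assms
proof (induction n arbitrary: k)
  case 0
  then show ?case by (simp add: hermite_sum_def one_pCons)
next
  case (Suc n)
  have top: "c (Suc n) = d (Suc n)"
    using Suc.prems(1) coeff_hermite_sum_self[of "Suc n" c] coeff_hermite_sum_self[of "Suc n" d] by simp
  then have "hermite_sum n c = hermite_sum n d"
    using Suc.prems(1) by (simp add: hermite_sum_def del: hermite.simps)
  then show ?case using Suc top by (cases "k = Suc n") auto
qed

lemma hermite_sum_pad:
  assumes "m \<le> n"
  shows "hermite_sum n (\<lambda>k. if k \<le> m then c k else 0) = hermite_sum m c"
  unfolding hermite_sum_def using assms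
  by (intro sum.mono_neutral_cong_right) auto

text \<open>Resolves the \<open>THE\<close> in \<open>hermite_op\<close>: coefficients are unique,
  and padding with zeros reconciles \<open>n\<close> with the degree used in the definition. The
  linearity and coefficient facts below rest on this.\<close>

lemma hermite_op_hermite_sum:
  "hermite_op lam (hermite_sum n c) = hermite_sum n (\<lambda>k. lam k * c k)"
proof -
  define p where "p = hermite_sum n c"
  define m where "m = degree p"
  have mn: "m \<le> n" unfolding m_def p_def by (rule degree_hermite_sum_le)
  have uniq: "hermite_sum m (\<lambda>k. lam k * d k) = hermite_sum n (\<lambda>k. lam k * c k)"
    if "p = hermite_sum m d" for d
  proof -
    have eq: "hermite_sum n c = hermite_sum n (\<lambda>k. if k \<le> m then d k else 0)"
      using that mn by (simp add: hermite_sum_pad p_def)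
    have "c k = (if k \<le> m then d k else 0)" if "k \<le> n" for k
      by (rule hermite_sum_inject[OF eq that])
    then have "hermite_sum n (\<lambda>k. lam k * c k) = hermite_sum n (\<lambda>k. if k \<le> m then lam k * d k else 0)"
      unfolding hermite_sum_def by (intro sum.cong) auto
    then show ?thesis using mn by (simp add: hermite_sum_pad)
  qed
  obtain d where d: "p = hermite_sum m d" using hermite_expansion[of p m] by (auto simp: m_def)
  show ?thesis
    unfolding hermite_op_def hermite_sum_def[symmetric] p_def[symmetric] m_def[symmetric]
  proof (rule the_equality)
    show "\<exists>c'. p = hermite_sum m c' \<and> hermite_sum n (\<lambda>k. lam k * c k) = hermite_sum m (\<lambda>k. lam k * c' k)"
      using d uniq[OF d] by auto
  qed (use uniq in auto)
qed

lemma hermite_sum_add: "hermite_sum n c + hermite_sum n d = hermite_sum n (\<lambda>k. c k + d k)"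
  by (simp add: hermite_sum_def sum.distrib smult_add_left)

lemma smult_hermite_sum: "smult a (hermite_sum n c) = hermite_sum n (\<lambda>k. a * c k)"
  unfolding hermite_sum_def by (induction n) (simp_all add: smult_add_right del: hermite.simps)

lemma hermite_op_add: "hermite_op lam (p + q) = hermite_op lam p + hermite_op lam q"
proof -
  define n where "n = max (degree p) (degree q)"
  obtain c where c: "p = hermite_sum n c" using hermite_expansion[of p n] by (auto simp: n_def)
  obtain d where d: "q = hermite_sum n d" using hermite_expansion[of q n] by (auto simp: n_def)
  show ?thesis
    unfolding c d by (simp add: hermite_op_hermite_sum hermite_sum_add distrib_left)
qed

lemma hermite_op_smult: "hermite_op lam (smult a p) = smult a (hermite_op lam p)"
proof -
  obtain c where c: "p = hermite_sum (degree p) c"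
    using hermite_expansion[of p "degree p"] by auto
  have "hermite_op lam (smult a (hermite_sum (degree p) c)) = smult a (hermite_op lam (hermite_sum (degree p) c))"
    by (simp add: hermite_op_hermite_sum smult_hermite_sum mult.left_commute)
  then show ?thesis using c by metis
qed

lemma hermite_op_hermite: "hermite_op lam (hermite n) = smult (lam n) (hermite n)"
proof -
  have *: "hermite_sum n (\<lambda>k. if k = n then a else 0) = smult a (hermite n)" for a
    unfolding hermite_sum_def by (subst sum.remove[of _ n]) auto
  have "hermite_op lam (hermite n) = hermite_op lam (hermite_sum n (\<lambda>k. if k = n then 1 else 0))"
    by (simp only: *) simp
  also have "\<dots> = hermite_sum n (\<lambda>k. if k = n then lam n else 0)"
    unfolding hermite_op_hermite_sum by (intro arg_cong[of _ _ "hermite_sum n"]) auto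
  finally show ?thesis by (simp only: *)
qed

lemma hermite_op_0 [simp]: "hermite_op lam 0 = 0"
  using hermite_op_smult[of lam 0 0] by simp

lemma hermite_op_sum: "hermite_op lam (sum f A) = (\<Sum>x\<in>A. hermite_op lam (f x))"
  by (induction A rule: infinite_finite_induct) (simp_all add: hermite_op_add)

lemma degree_hermite_op_le:
  assumes "degree p \<le> n"
  shows "degree (hermite_op lam p) \<le> n"
proof -
  obtain c where "p = hermite_sum n c" using hermite_expansion[OF assms] .
  then show ?thesis by (simp add: hermite_op_hermite_sum degree_hermite_sum_le)
qed

lemma coeff_hermite_op_top:
  assumes "degree p \<le> n"
  shows "coeff (hermite_op lam p) n = lam n * coeff p n"
proof -
  obtain c where "p = hermite_sum n c" using hermite_expansion[OF assms] .
  then show ?thesis by (simp add: hermite_op_hermite_sum coeff_hermite_sum_self)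
qed

section \<open>Finite differences and Jensen polynomials\<close>

definition fwd_diff :: "(nat \<Rightarrow> real) \<Rightarrow> nat \<Rightarrow> real" where
  "fwd_diff lam n = lam (Suc n) - lam n"

lemma sum_binomial_Suc:
  fixes g :: "nat \<Rightarrow> 'a::comm_semiring_1"
  shows "(\<Sum>k\<le>Suc n. of_nat (Suc n choose k) * g k)
       = (\<Sum>k\<le>n. of_nat (n choose k) * g k) + (\<Sum>k\<le>n. of_nat (n choose k) * g (Suc k))"
proof -
  have "(\<Sum>k\<le>Suc n. of_nat (Suc n choose k) * g k)
      = g 0 + (\<Sum>k\<le>n. of_nat (n choose Suc k) * g (Suc k)) + (\<Sum>k\<le>n. of_nat (n choose k) * g (Suc k))"
    by (subst sum.atMost_Suc_shift) (simp add: sum.distrib algebra_simps)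
  also have "g 0 + (\<Sum>k\<le>n. of_nat (n choose Suc k) * g (Suc k)) = (\<Sum>k\<le>Suc n. of_nat (n choose k) * g k)"
    by (subst sum.atMost_Suc_shift) simp
  finally show ?thesis by (simp add: binomial_eq_0)
qed

text \<open>With shift \<open>E\<close> and difference \<open>E - 1\<close>, this is
  \<open>(1 + z (E - 1))^n = ((1 - z) + z E)^n\<close> applied to \<open>lam\<close> at
  \<open>0\<close>. The case \<open>z = 1\<close> is Newton's formula; complex \<open>z\<close>
  relates the Jensen polynomials of \<open>lam\<close> to those of its differences.\<close>

lemma newton_binomial:
  fixes z :: "'a::real_field"
  shows "(\<Sum>k\<le>n. of_nat (n choose k) * (of_real ((fwd_diff ^^ k) lam 0) * z ^ k))
       = (\<Sum>k\<le>n. of_nat (n choose k) * (of_real (lam k) * z ^ k * (1 - z) ^ (n - k)))"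
proof (induction n arbitrary: lam)
  case (Suc n)
  let ?L = "\<lambda>lam. \<Sum>k\<le>n. of_nat (n choose k) * (of_real ((fwd_diff ^^ k) lam 0) * z ^ k)"
  let ?R = "\<lambda>lam. \<Sum>k\<le>n. of_nat (n choose k) * (of_real (lam k) * z ^ k * (1 - z) ^ (n - k))"
  have "(\<Sum>k\<le>Suc n. of_nat (Suc n choose k) * (of_real ((fwd_diff ^^ k) lam 0) * z ^ k))
      = ?L lam + z * ?L (fwd_diff lam)"
    by (subst sum_binomial_Suc)
      (simp add: sum_distrib_left funpow_swap1 mult_ac del: binomial_Suc_Suc)
  also have "\<dots> = ?R lam + z * ?R (fwd_diff lam)"
    by (simp only: Suc.IH)
  also have "\<dots> = (\<Sum>k\<le>n. of_nat (n choose k) * (of_real (lam k) * z ^ k * (1 - z) ^ (Suc n - k)))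
      + (\<Sum>k\<le>n. of_nat (n choose k) * (of_real (lam (Suc k)) * z ^ Suc k * (1 - z) ^ (Suc n - Suc k)))"
    unfolding sum_distrib_left sum.distrib[symmetric]
    by (intro sum.cong refl) (simp add: fwd_diff_def Suc_diff_le algebra_simps)
  also have "\<dots> = (\<Sum>k\<le>Suc n. of_nat (Suc n choose k) * (of_real (lam k) * z ^ k * (1 - z) ^ (Suc n - k)))"
    by (rule sum_binomial_Suc[symmetric])
  finally show ?case .
qed simp

lemma newton_forward: "lam n = (\<Sum>k\<le>n. of_nat (n choose k) * (fwd_diff ^^ k) lam 0)"
proof -
  have "(\<Sum>k\<le>n. of_nat (n choose k) * (fwd_diff ^^ k) lam 0)
      = (\<Sum>k\<le>n. of_nat (n choose k) * (lam k * 0 ^ (n - k)))"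
    using newton_binomial[of n lam "1::real"] by simp
  also have "\<dots> = (\<Sum>k\<le>n. if k = n then lam n else 0)"
    by (intro sum.cong) (auto simp: power_0_left)
  finally show ?thesis by simp
qed

text \<open>All derivatives act before all raising operators. Truncation at \<open>n\<close> loses
  nothing once \<open>n\<close> reaches the degree of \<open>p\<close>.\<close>

definition normal_op :: "nat \<Rightarrow> (nat \<Rightarrow> real) \<Rightarrow> real poly \<Rightarrow> real poly" where
  "normal_op n F p = (\<Sum>k\<le>n. smult (F k) ((raising ^^ k) ((pderiv ^^ k) p)))"

lemma normal_op_add: "normal_op n F (p + q) = normal_op n F p + normal_op n F q"
  by (simp add: normal_op_def higher_pderiv_add raising_pow_add smult_add_right sum.distrib)

lemma normal_op_smult: "normal_op n F (smult c p) = smult c (normal_op n F p)"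
  unfolding normal_op_def higher_pderiv_smult raising_pow_smult
  by (induction n) (simp_all add: smult_add_right mult.commute)

lemma normal_op_hermite_sum:
  "normal_op n F (hermite_sum m c) = (\<Sum>k\<le>m. smult (c k) (normal_op n F (hermite k)))"
  unfolding hermite_sum_def
  by (induction m) (simp_all add: normal_op_add normal_op_smult del: hermite.simps)

lemma pderiv_pow_hermite:
  assumes "k \<le> n"
  shows "(pderiv ^^ k) (hermite n) = smult (2 ^ k * fact k * real (n choose k)) (hermite (n - k))"
  using assms
proof (induction k)
  case (Suc k)
  obtain j where j: "n - k = Suc j" using Suc.prems by (metis Suc_diff_Suc Suc_le_lessD)
  have "pderiv ((pderiv ^^ k) (hermite n))
     = smult (2 ^ k * fact k * real (n choose k)) (pderiv (hermite (Suc j)))"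
    using Suc j by (simp add: pderiv_smult del: hermite.simps)
  also have "\<dots> = smult (2 ^ k * fact k * (2 * (real (n choose k) * real (Suc j)))) (hermite j)"
    unfolding pderiv_hermite_Suc smult_smult by (simp only: mult_ac)
  also have "real (n choose k) * real (Suc j) = real (Suc k) * real (n choose Suc k)"
  proof -
    have "(n choose k) * (n - k) = Suc k * (n choose Suc k)"
      using binomial_absorb_comp[of n k] binomial_absorption[of k n] by (simp add: mult.commute)
    then show ?thesis unfolding j by (metis of_nat_mult)
  qed
  finally have "(pderiv ^^ Suc k) (hermite n)
      = smult (2 ^ Suc k * fact (Suc k) * real (n choose Suc k)) (hermite j)"
    by (simp add: mult_ac del: hermite.simps)
  moreover have "j = n - Suc k" using j by linarith
  ultimately show ?case by simp
qed simp

lemma raising_pow_hermite: "(raising ^^ k) (hermite n) = smult (1 / 2 ^ k) (hermite (n + k))"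
  by (induction k) (simp_all add: raising_smult raising_hermite mult.commute del: hermite.simps)

text \<open>The powers of 2 from lowering and raising cancel, so the \<open>k\<close>-th summand has
  the falling factorial \<open>fact k * (n choose k)\<close> as eigenvalue.\<close>

lemma normal_op_hermite:
  assumes "n \<le> m"
  shows "normal_op m F (hermite n) = smult (\<Sum>k\<le>n. fact k * F k * real (n choose k)) (hermite n)"
proof -
  have 1: "smult (F k) ((raising ^^ k) ((pderiv ^^ k) (hermite n)))
      = smult (fact k * F k * real (n choose k)) (hermite n)" if "k \<le> n" for k
    using that by (simp add: pderiv_pow_hermite raising_pow_smult raising_pow_hermite mult_ac del: hermite.simps)
  have 2: "(pderiv ^^ k) (hermite n) = 0" if "k > n" for k
  proof -
    have "(pderiv ^^ n) (hermite n) = [:2 ^ n * fact n:]"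
      using pderiv_pow_hermite[of n n] by simp
    then have "(pderiv ^^ (Suc j + n)) (hermite n) = 0" for j
      unfolding funpow_add by (simp add: funpow_swap1)
    then show ?thesis using that less_iff_Suc_add by (metis add.commute add_Suc)
  qed
  have 3: "(raising ^^ k) (0::real poly) = 0" for k by (induction k) auto
  have "normal_op m F (hermite n) = (\<Sum>k\<le>n. smult (F k) ((raising ^^ k) ((pderiv ^^ k) (hermite n))))"
    unfolding normal_op_def using assms by (intro sum.mono_neutral_right) (auto simp: 2 3)
  also have "\<dots> = (\<Sum>k\<le>n. smult (fact k * F k * real (n choose k)) (hermite n))"
    by (intro sum.cong refl 1) auto
  also have "\<dots> = smult (\<Sum>k\<le>n. fact k * F k * real (n choose k)) (hermite n)"
    by (simp add: smult_sum)
  finally show ?thesis .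
qed

text \<open>Newton's formula writes \<open>lam n\<close> in falling factorials, which are the
  eigenvalues of the normally ordered monomials.\<close>

lemma hermite_op_eq_normal_op:
  assumes "degree p \<le> n"
  shows "hermite_op lam p = normal_op n (\<lambda>k. (fwd_diff ^^ k) lam 0 / fact k) p"
proof -
  obtain c where c: "p = hermite_sum n c" using hermite_expansion[OF assms] .
  show ?thesis unfolding c hermite_op_hermite_sum normal_op_hermite_sum
    unfolding hermite_sum_def
    by (intro sum.cong refl)
      (simp add: normal_op_hermite newton_forward[of lam, symmetric] mult.commute del: hermite.simps)
qed

section \<open>Jensen polynomials and Turan inequalities\<close>

definition jensen :: "(nat \<Rightarrow> real) \<Rightarrow> nat \<Rightarrow> real poly" where
  "jensen lam n = (\<Sum>k\<le>n. monom (real (n choose k) * lam k) k)"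

text \<open>This is the only consequence of the multiplier property that the argument draws on, and
  it passes easily to shifts and differences.\<close>

definition jensen_real_rooted :: "(nat \<Rightarrow> real) \<Rightarrow> bool" where
  "jensen_real_rooted lam \<longleftrightarrow> (\<forall>n. real_rooted (jensen lam n))"

lemma coeff_jensen: "coeff (jensen lam n) k = real (n choose k) * lam k"
proof -
  have "coeff (jensen lam n) k = (\<Sum>i\<le>n. if i = k then real (n choose k) * lam k else 0)"
    unfolding jensen_def coeff_sum by (intro sum.cong) auto
  then show ?thesis by (auto simp: sum.delta' binomial_eq_0)
qed

lemma degree_jensen_le: "degree (jensen lam n) \<le> n"
  by (rule degree_le) (simp add: coeff_jensen binomial_eq_0)

lemma poly_cpoly_jensen:
  "poly (cpoly (jensen lam n)) z = (\<Sum>k\<le>n. of_nat (n choose k) * (of_real (lam k) * z ^ k))"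
proof -
  have "poly (cpoly (jensen lam n)) z = (\<Sum>k\<le>n. coeff (cpoly (jensen lam n)) k * z ^ k)"
    unfolding poly_altdef using degree_jensen_le[of lam n]
    by (intro sum.mono_neutral_left) (auto simp: coeff_eq_0)
  then show ?thesis by (simp add: coeff_jensen mult_ac)
qed

lemma multiplier_sequence_imp_jensen_real_rooted:
  assumes "multiplier_sequence lam"
  shows "jensen_real_rooted lam"
  unfolding jensen_real_rooted_def
proof
  fix n
  have "real_rooted ([:1, 1:] ^ n)"
  proof (induction n)
    case 0
    then show ?case by (simp add: real_rooted_def)
  next
    case (Suc n)
    then show ?case unfolding power_Suc by (intro real_rooted_mult real_rooted_linear)
  qed
  moreover have "classical_op lam ([:1, 1:] ^ n) = jensen lam n"
    unfolding classical_op_def jensen_def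
    by (simp add: degree_linear_power coeff_linear_poly_power mult.commute)
  ultimately show "real_rooted (jensen lam n)"
    using assms unfolding multiplier_sequence_def by metis
qed

lemma jensen_Suc: "jensen lam (Suc n) = jensen lam n + pCons 0 (jensen (\<lambda>k. lam (Suc k)) n)"
  by (intro poly_eqI) (simp add: coeff_jensen coeff_pCons algebra_simps split: nat.splits)

lemma pderiv_jensen_Suc:
  "pderiv (jensen lam (Suc n)) = smult (real (Suc n)) (jensen (\<lambda>k. lam (Suc k)) n)"
proof (intro poly_eqI)
  fix k
  have "real (Suc k) * real (Suc n choose Suc k) = real (Suc n) * real (n choose k)"
    by (metis Suc_times_binomial of_nat_mult)
  then show "coeff (pderiv (jensen lam (Suc n))) k
      = coeff (smult (real (Suc n)) (jensen (\<lambda>k. lam (Suc k)) n)) k"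
    unfolding coeff_pderiv coeff_jensen coeff_smult by (metis (no_types) mult.assoc)
qed

text \<open>Identifies a polar derivative of a Jensen polynomial as a Jensen polynomial, so
  \<open>real_rooted_polar\<close> applies. \<open>t = 0\<close> gives the shifted sequence and
  \<open>t = 1\<close> the forward difference.\<close>

lemma jensen_shift_diff:
  "smult (real (Suc n)) (jensen (\<lambda>k. lam (Suc k) - t * lam k) n)
   = [:1, t:] * pderiv (jensen lam (Suc n)) - smult (t * real (Suc n)) (jensen lam (Suc n))"
proof -
  define N where "N = real (Suc n)"
  have "jensen (\<lambda>k. lam (Suc k) - t * lam k) n = jensen (\<lambda>k. lam (Suc k)) n - smult t (jensen lam n)"
    by (intro poly_eqI) (simp add: coeff_jensen algebra_simps)
  then show ?thesis
    unfolding pderiv_jensen_Suc unfolding jensen_Suc N_def[symmetric]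
    by (simp add: smult_diff_right smult_add_right mult.commute)
qed

lemma jensen_real_rooted_shift_diff:
  assumes "jensen_real_rooted lam"
  shows "jensen_real_rooted (\<lambda>k. lam (Suc k) - t * lam k)"
  unfolding jensen_real_rooted_def
proof
  fix n
  have "real_rooted ([:1, t:] * pderiv (jensen lam (Suc n)) - smult (t * real (Suc n)) (jensen lam (Suc n)))"
    using assms degree_jensen_le[of lam "Suc n"] unfolding jensen_real_rooted_def
    by (intro real_rooted_polar) (auto simp del: of_nat_Suc)
  then show "real_rooted (jensen (\<lambda>k. lam (Suc k) - t * lam k) n)"
    unfolding jensen_shift_diff[symmetric] by (subst (asm) real_rooted_smult_iff) auto
qed

lemma jensen_real_rooted_shift:
  assumes "jensen_real_rooted lam"
  shows "jensen_real_rooted (\<lambda>k. lam (k + n))"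
proof (induction n)
  case (Suc n)
  then show ?case using jensen_real_rooted_shift_diff[OF Suc, of 0] by simp
qed (use assms in simp)

lemma jensen_real_rooted_turan:
  assumes "jensen_real_rooted lam"
  shows "lam n * lam (n + 2) \<le> (lam (n + 1))\<^sup>2"
proof -
  have "jensen (\<lambda>k. lam (k + n)) 2 = [:lam n, 2 * lam (n + 1), lam (n + 2):]"
    by (intro poly_eqI) (auto simp: coeff_jensen coeff_pCons numeral_2_eq_2 add_ac split: nat.splits)
  then show ?thesis
    using jensen_real_rooted_shift[OF assms, of n] real_rooted_quadratic
    unfolding jensen_real_rooted_def by metis
qed

text \<open>\<open>t = 1 - c\<close> turns \<open>lam (Suc k) - t * lam k\<close> into difference
  plus \<open>c * lam k\<close>. The free parameter \<open>c\<close> is what makes convexity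
  provable.\<close>

lemma jensen_real_rooted_turan_fwd_diff:
  assumes "jensen_real_rooted lam"
  shows "(fwd_diff lam n + c * lam n) * (fwd_diff lam (n + 2) + c * lam (n + 2))
       \<le> (fwd_diff lam (n + 1) + c * lam (n + 1))\<^sup>2"
  using jensen_real_rooted_turan[OF jensen_real_rooted_shift_diff[OF assms, of "1 - c"], of n]
  by (simp add: fwd_diff_def algebra_simps)

text \<open>If positive values resumed at \<open>m = a + N\<close>, the shifted Jensen polynomial of
  index \<open>N >= 2\<close> would be the binomial \<open>lam a + lam m * z^N\<close>, which has
  the nonreal root \<open>r * cis (pi / N)\<close>.\<close>

lemma jensen_real_rooted_no_gap:
  assumes rr: "jensen_real_rooted lam" and nonneg: "\<And>n. lam n \<ge> 0"
    and a: "lam a > 0" "lam (Suc a) = 0" and ab: "a < b"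
  shows "lam b = 0"
proof (rule ccontr)
  assume "lam b \<noteq> 0"
  define m where "m = (LEAST m. a < m \<and> lam m \<noteq> 0)"
  have m: "a < m" "lam m \<noteq> 0"
    using LeastI[of "\<lambda>m. a < m \<and> lam m \<noteq> 0" b] ab \<open>lam b \<noteq> 0\<close> by (auto simp: m_def)
  have between: "lam k = 0" if "a < k" "k < m" for k
    using not_less_Least[of k "\<lambda>m. a < m \<and> lam m \<noteq> 0"] that by (auto simp: m_def)
  have "m \<noteq> Suc a" using m a by auto
  define N where "N = m - a"
  have N: "N \<ge> 2" "m = N + a" using m \<open>m \<noteq> Suc a\<close> by (auto simp: N_def)
  have eval: "poly (cpoly (jensen (\<lambda>k. lam (k + a)) N)) z = of_real (lam a) + of_real (lam m) * z ^ N" for z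
  proof -
    have "poly (cpoly (jensen (\<lambda>k. lam (k + a)) N)) z
        = (\<Sum>k\<in>{0, N}. of_nat (N choose k) * (of_real (lam (k + a)) * z ^ k))"
      unfolding poly_cpoly_jensen
      using N between by (intro sum.mono_neutral_right) auto
    then show ?thesis using N by simp
  qed
  define r where "r = root N (lam a / lam m)"
  have q: "lam a / lam m > 0" using a m nonneg[of m] by (simp add: less_le)
  then have r: "r > 0" "r ^ N = lam a / lam m" using N by (auto simp: r_def)
  define z where "z = of_real r * cis (pi / N)"
  have "z ^ N = - of_real (lam a / lam m)"
    using N(1) by (simp add: z_def power_mult_distrib DeMoivre r(2)[symmetric])
  then have root: "poly (cpoly (jensen (\<lambda>k. lam (k + a)) N)) z = 0"
    using m by (simp add: eval)
  have "jensen (\<lambda>k. lam (k + a)) N \<noteq> 0"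
    using coeff_jensen[of "\<lambda>k. lam (k + a)" N 0] a by auto
  then have "Im z = 0"
    using real_rooted_imp_Im_eq_0 root jensen_real_rooted_shift[OF rr, of a]
    unfolding jensen_real_rooted_def by blast
  moreover have "sin (pi / N) > 0"
    using N by (intro sin_gt_zero) (auto simp: field_simps)
  ultimately show False using r by (simp add: z_def)
qed

text \<open>A failure of convexity would make the differences \<open>mu\<close> decay geometrically with some limiting
  ratio \<open>\<rho> < 1\<close>; dividing the Turan inequality for \<open>mu + c lam\<close> by \<open>mu n * lam n\<close> and letting \<open>n\<close>
  tend to infinity then forces \<open>c \<ge> 1 - \<rho>\<close> for every \<open>c > 0\<close>.\<close>

lemma fwd_diff_mono:
  assumes rr: "jensen_real_rooted lam" and nonneg: "\<And>n. lam n \<ge> 0"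
    and incr: "\<And>n. lam n \<le> lam (Suc n)"
  shows "fwd_diff lam n \<le> fwd_diff lam (Suc n)"
proof (rule ccontr)
  define mu where "mu = fwd_diff lam"
  assume "\<not> fwd_diff lam n \<le> fwd_diff lam (Suc n)"
  then have drop: "mu (Suc n) < mu n" by (simp add: mu_def)
  have mu_nonneg: "mu k \<ge> 0" for k using incr by (simp add: mu_def fwd_diff_def)
  have lam_Suc: "lam (Suc k) = lam k + mu k" for k by (simp add: mu_def fwd_diff_def)
  have mu_rr: "jensen_real_rooted mu"
    using jensen_real_rooted_shift_diff[OF rr, of 1] by (simp add: mu_def fwd_diff_def[abs_def])
  have turan: "(mu k + c * lam k) * (mu (k + 2) + c * lam (k + 2)) \<le> (mu (k + 1) + c * lam (k + 1))\<^sup>2" for k c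
    using jensen_real_rooted_turan_fwd_diff[OF rr] by (simp add: mu_def)
  have no_vanish: False if k: "mu k > 0" "mu (Suc k) = 0" for k
  proof -
    have "mu (k + 2) = 0" using jensen_real_rooted_no_gap[OF mu_rr mu_nonneg k, of "k + 2"] by simp
    define L where "L = lam k + mu k"
    have L: "L > 0" "lam (k + 1) = L" "lam (k + 2) = L" "lam k = L - mu k"
      using k nonneg[of k] lam_Suc[of k] lam_Suc[of "Suc k"] by (auto simp: L_def)
    \<comment> \<open>Here \<open>lam\<close> is constant, equal to \<open>L\<close>, at the next
      two indices; \<open>c = 1/2\<close> makes the Turan defect
      \<open>L * mu k / 4\<close>.\<close>
    have "(mu k + (1/2) * (L - mu k)) * ((1/2) * L) \<le> ((1/2) * L)\<^sup>2"
      using turan[of k "1/2"] k L \<open>mu (k + 2) = 0\<close> by simp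
    moreover have "(mu k + (1/2) * (L - mu k)) * ((1/2) * L) - ((1/2) * L)\<^sup>2 = L * mu k / 4"
      by (simp add: power2_eq_square field_simps)
    ultimately have "L * mu k \<le> 0" by linarith
    then show False using k L by (simp add: mult_le_0_iff)
  qed
  have pos: "mu k > 0" if "n \<le> k" for k
    using that
  proof (induction k rule: dec_induct)
    case base
    then show ?case using drop mu_nonneg[of "Suc n"] by simp
  next
    case (step k)
    then show ?case using no_vanish[of k] mu_nonneg[of "Suc k"] by (auto simp: less_le)
  qed
  define rho where "rho k = mu (Suc (k + n)) / mu (k + n)" for k
  have rho_pos: "rho k > 0" for k using pos by (simp add: rho_def)
  have rho_decr: "rho (Suc k) \<le> rho k" for k
    using jensen_real_rooted_turan[OF mu_rr, of "k + n"] pos[of "k + n"] pos[of "Suc (k + n)"]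
    by (simp add: rho_def field_simps power2_eq_square)
  then have "decseq rho" by (simp add: decseq_Suc_iff)
  then obtain r where r: "rho \<longlonglongrightarrow> r" "\<And>k. r \<le> rho k"
    using decseq_convergent[of rho 0] rho_pos less_imp_le by blast
  have "rho 0 < 1" using drop pos[of n] by (simp add: rho_def)
  then have "r < 1" using r(2)[of 0] by simp
  have rho_le: "rho k \<le> rho 0" for k using \<open>decseq rho\<close> by (simp add: decseq_def)
  have mu_bound: "mu (k + n) \<le> mu n * rho 0 ^ k" for k
  proof (induction k)
    case (Suc k)
    have "mu (Suc k + n) = mu (k + n) * rho k" using pos[of "k + n"] by (simp add: rho_def)
    also have "\<dots> \<le> (mu n * rho 0 ^ k) * rho 0"
      using Suc rho_le[of k] rho_pos[of k] pos[of n] rho_pos[of 0] by (intro mult_mono) auto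
    finally show ?case by (simp add: mult_ac)
  qed simp
  have "(\<lambda>k. mu n * rho 0 ^ k) \<longlonglongrightarrow> mu n * 0"
    using \<open>rho 0 < 1\<close> rho_pos[of 0] by (intro tendsto_intros LIMSEQ_power_zero) auto
  then have bound_lim: "(\<lambda>k. mu n * rho 0 ^ k) \<longlonglongrightarrow> 0" by simp
  have mu_lim: "(\<lambda>k. mu (k + n)) \<longlonglongrightarrow> 0"
    by (rule tendsto_sandwich[OF _ _ tendsto_const bound_lim])
      (intro always_eventually allI mu_nonneg mu_bound)+
  \<comment> \<open>A positive lower bound on \<open>lam\<close> makes the quotients
    \<open>mu / lam\<close> vanish in the limit.\<close>
  have lam_ge: "mu n \<le> lam (Suc (k + n))" for k
  proof (induction k)
    case 0
    then show ?case using lam_Suc[of n] nonneg[of n] by simp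
  next
    case (Suc k)
    then show ?case using incr[of "Suc (k + n)"] by simp
  qed
  define w where "w k = mu (Suc (k + n)) / lam (Suc (k + n))" for k
  have w_lim: "w \<longlonglongrightarrow> 0"
  proof (rule tendsto_sandwich[OF _ _ tendsto_const[of 0]])
    show "\<forall>\<^sub>F k in sequentially. 0 \<le> w k" using mu_nonneg nonneg by (simp add: w_def)
    show "\<forall>\<^sub>F k in sequentially. w k \<le> mu (Suc (k + n)) / mu n"
      using lam_ge pos[of n] mu_nonneg by (auto simp: w_def intro!: divide_left_mono mult_pos_pos always_eventually
          less_le_trans[OF pos[of n] lam_ge])
    show "(\<lambda>k. mu (Suc (k + n)) / mu n) \<longlonglongrightarrow> 0"
      using tendsto_divide[OF LIMSEQ_Suc[OF mu_lim] tendsto_const[of "mu n"]] pos[of n] by simp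
  qed
  \<comment> \<open>The limit of \<open>E\<close> is \<open>c (1 - r) (c - (1 - r))\<close>,
    negative for \<open>0 < c < 1 - r\<close>; the midpoint is taken.\<close>
  define c where "c = (1 - r) / 2"
  \<comment> \<open>The Turan difference at index \<open>Suc (k + n)\<close> divided by
    \<open>mu * lam\<close> there, written in the ratios \<open>rho\<close> and \<open>w\<close>,
    whose limits are known.\<close>
  define E where "E k = c\<^sup>2 * (1 - rho (Suc k) + w k)
      + c * (2 * rho (Suc k) - 1 - rho (Suc k) * rho (Suc (Suc k)) + w k * (rho (Suc k) - 1))
      + w k * (rho (Suc k) ^ 2 - rho (Suc k) * rho (Suc (Suc k)))" for k
  have E_nonneg: "0 \<le> E k" for k
  proof -
    let ?j = "Suc (k + n)"
    define x l where "x = mu ?j" and "l = lam ?j"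
    have x: "x > 0" using pos[of ?j] by (simp add: x_def)
    have l: "l > 0" using lam_ge[of k] pos[of n] by (simp add: l_def)
    have w: "x = w k * l" using l by (simp add: w_def x_def l_def)
    have mu1: "mu (?j + 1) = x * rho (Suc k)" using x by (simp add: rho_def x_def)
    have mu2: "mu (?j + 2) = x * rho (Suc k) * rho (Suc (Suc k))"
      using mu1 pos[of "Suc ?j"] by (simp add: rho_def)
    have lam1: "lam (?j + 1) = l + x" using lam_Suc[of ?j] by (simp add: l_def x_def)
    have lam2: "lam (?j + 2) = l + x + x * rho (Suc k)"
      using lam_Suc[of "Suc ?j"] lam1 mu1 by simp
    have "(x + c * l) * (x * rho (Suc k) * rho (Suc (Suc k)) + c * (l + x + x * rho (Suc k)))
          \<le> (x * rho (Suc k) + c * (l + x))\<^sup>2"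
      using turan[of ?j c] unfolding mu1 mu2 lam1 lam2 by (simp add: x_def l_def)
    then have "0 \<le> (x * rho (Suc k) + c * (l + x))\<^sup>2
        - (x + c * l) * (x * rho (Suc k) * rho (Suc (Suc k)) + c * (l + x + x * rho (Suc k)))" by simp
    also have "\<dots> = x * l * E k"
      unfolding E_def w by (simp add: power2_eq_square algebra_simps)
    finally show ?thesis using mult_pos_pos[OF x l] by (simp only: zero_le_mult_iff) auto
  qed
  have rho1: "(\<lambda>k. rho (Suc k)) \<longlonglongrightarrow> r" and rho2: "(\<lambda>k. rho (Suc (Suc k))) \<longlonglongrightarrow> r"
    using r(1) LIMSEQ_Suc by blast+
  have "E \<longlonglongrightarrow> c\<^sup>2 * (1 - r + 0) + c * (2 * r - 1 - r * r + 0 * (r - 1)) + 0 * (r ^ 2 - r * r)"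
    unfolding E_def by (intro tendsto_intros rho1 rho2 w_lim)
  then have "0 \<le> c\<^sup>2 * (1 - r + 0) + c * (2 * r - 1 - r * r + 0 * (r - 1)) + 0 * (r ^ 2 - r * r)"
    using E_nonneg by (intro LIMSEQ_le_const) auto
  also have "\<dots> = c * (1 - r) * (c - (1 - r))" by (simp add: power2_eq_square algebra_simps)
  also have "\<dots> = - ((1 - r) ^ 3 / 4)" by (simp add: c_def power3_eq_cube field_simps)
  finally show False using \<open>r < 1\<close> by (simp add: power_le_zero_eq zero_le_power)
qed

text \<open>All three hypotheses pass to \<open>fwd_diff lam\<close>: monotonicity becomes
  nonnegativity, and \<open>fwd_diff_mono\<close> supplies the new monotonicity.\<close>

lemma fwd_diff_pow_nonneg:
  assumes "jensen_real_rooted lam" "\<And>n. lam n \<ge> 0" "\<And>n. lam n \<le> lam (Suc n)"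
  shows "(fwd_diff ^^ k) lam n \<ge> 0"
  using assms
proof (induction k arbitrary: lam)
  case (Suc k)
  have "jensen_real_rooted (fwd_diff lam)"
    using jensen_real_rooted_shift_diff[OF Suc.prems(1), of 1] by (simp add: fwd_diff_def[abs_def])
  moreover have "fwd_diff lam n \<ge> 0" for n using Suc.prems(3) by (simp add: fwd_diff_def)
  ultimately have "(fwd_diff ^^ k) (fwd_diff lam) n \<ge> 0"
    using fwd_diff_mono[OF Suc.prems] by (intro Suc.IH) auto
  then show ?case by (simp add: funpow_swap1)
qed simp

text \<open>By \<open>newton_binomial\<close> the value at \<open>z\<close> is
  \<open>(1 - z)^n\<close> times that of \<open>jensen lam n\<close> at \<open>z / (1 - z)\<close>,
  and this real Moebius map sends nonreal points to nonreal points.\<close>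

lemma real_rooted_jensen_fwd_diff:
  assumes rr: "jensen_real_rooted lam"
  shows "real_rooted (jensen (\<lambda>k. (fwd_diff ^^ k) lam 0) n)"
proof (cases "jensen lam n = 0")
  case True
  then have "lam k = 0" if "k \<le> n" for k
    using coeff_jensen[of lam n k] that by simp
  then have "poly (cpoly (jensen (\<lambda>k. (fwd_diff ^^ k) lam 0) n)) z = 0" for z
    unfolding poly_cpoly_jensen newton_binomial by simp
  then have "cpoly (jensen (\<lambda>k. (fwd_diff ^^ k) lam 0) n) = 0"
    by (metis poly_all_0_iff_0)
  then show ?thesis by simp
next
  case False
  have "poly (cpoly (jensen (\<lambda>k. (fwd_diff ^^ k) lam 0) n)) z \<noteq> 0" if z: "Im z > 0" for z
  proof
    assume *: "poly (cpoly (jensen (\<lambda>k. (fwd_diff ^^ k) lam 0) n)) z = 0"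
    have nz: "1 - z \<noteq> 0" using z by (auto simp: complex_eq_iff)
    define u where "u = z / (1 - z)"
    have "(1 - z) ^ n * poly (cpoly (jensen lam n)) u
        = (\<Sum>k\<le>n. of_nat (n choose k) * (of_real (lam k) * z ^ k * (1 - z) ^ (n - k)))"
      unfolding poly_cpoly_jensen sum_distrib_left u_def using nz
      by (intro sum.cong refl) (simp add: power_divide power_diff)
    also have "\<dots> = 0"
      using * unfolding poly_cpoly_jensen newton_binomial .
    finally have "poly (cpoly (jensen lam n)) u = 0" using nz by simp
    then have "Im u = 0"
      using rr False real_rooted_imp_Im_eq_0 unfolding jensen_real_rooted_def by blast
    then have "u = of_real (Re u)" by (simp add: complex_eq_iff)
    then have "z = of_real (Re u) * (1 - z)" using nz by (simp add: u_def field_simps)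
    then have "Im z = Re u * (- Im z)" "Re z = Re u * (1 - Re z)"
      by (simp_all add: complex_eq_iff)
    then have "Im z * (1 + Re u) = 0" "Re z = Re u * (1 - Re z)" by (simp_all add: algebra_simps)
    then have "Re u = -1" "Re z = Re u * (1 - Re z)" using z by auto
    then show False by simp
  qed
  then show ?thesis by (simp add: real_rooted_iff_upper_half_plane)
qed

section \<open>Stable polynomials in two variables\<close>

text \<open>A polynomial in \<open>y\<close> whose coefficients are polynomials in \<open>x\<close>.\<close>

definition eval2 :: "complex poly poly \<Rightarrow> complex \<Rightarrow> complex \<Rightarrow> complex" where
  "eval2 p x y = poly (poly p [:y:]) x"

definition stable2 :: "complex poly poly \<Rightarrow> bool" where
  "stable2 p \<longleftrightarrow> (\<forall>x y. Im x > 0 \<longrightarrow> Im y > 0 \<longrightarrow> eval2 p x y \<noteq> 0)"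

abbreviation pderiv_x :: "complex poly poly \<Rightarrow> complex poly poly" where
  "pderiv_x p \<equiv> map_poly pderiv p"

text \<open>On the diagonal \<open>y = x\<close> the two partial derivatives add up to the full
  derivative, so this becomes \<open>raising\<close>. Unlike \<open>raising\<close>, it commutes
  with the derivative that it is paired with, the one in \<open>y\<close>.\<close>

definition raising2 :: "complex poly poly \<Rightarrow> complex poly poly" where
  "raising2 p = smult [:0, 1:] p - smult [:1/2:] (pderiv_x p + pderiv p)"

definition num2 :: "complex poly poly \<Rightarrow> complex poly poly" where
  "num2 p = raising2 (pderiv p)"

lemma eval2_y: "eval2 p x y = poly (map_poly (\<lambda>c. poly c x) p) y"
  unfolding eval2_def by (induction p) (auto simp: map_poly_pCons)

lemma pderiv_poly_const: "pderiv (poly p [:y:]) = poly (pderiv_x p) [:y:]"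
  by (induction p) (auto simp: map_poly_pCons pderiv_add pderiv_smult)

lemma pderiv_map_poly_eval:
  "pderiv (map_poly (\<lambda>c. poly c x) p) = map_poly (\<lambda>c. poly c x) (pderiv p)" for p :: "complex poly poly"
  by (intro poly_eqI) (simp add: coeff_pderiv coeff_map_poly algebra_simps)

lemma eval2_add: "eval2 (p + q) x y = eval2 p x y + eval2 q x y"
  by (simp add: eval2_def)

lemma eval2_diff: "eval2 (p - q) x y = eval2 p x y - eval2 q x y"
  by (simp add: eval2_def)

lemma eval2_smult: "eval2 (smult c p) x y = poly c x * eval2 p x y"
  by (simp add: eval2_def)

lemma eval2_raising2:
  "eval2 (raising2 p) x y = x * eval2 p x y - (eval2 (pderiv_x p) x y + eval2 (pderiv p) x y) / 2"
  by (simp add: raising2_def eval2_add eval2_diff eval2_smult)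

lemma stable2_log_deriv_x:
  assumes "stable2 p" "Im x > 0" "Im y > 0"
  obtains l where "eval2 (pderiv_x p) x y = l * eval2 p x y" "Im l \<le> 0"
proof -
  have nz: "poly (poly p [:y:]) w \<noteq> 0" if "Im w > 0" for w
    using assms that by (simp add: stable2_def eval2_def)
  show thesis
    by (rule log_deriv_upper_half_plane[OF nz assms(2)])
      (auto intro!: that simp: pderiv_poly_const eval2_def)
qed

lemma stable2_log_deriv_y:
  assumes "stable2 p" "Im x > 0" "Im y > 0"
  obtains l where "eval2 (pderiv p) x y = l * eval2 p x y" "Im l \<le> 0"
    "degree (map_poly (\<lambda>c. poly c x) p) > 0 \<Longrightarrow> Im l < 0"
proof -
  have nz: "poly (map_poly (\<lambda>c. poly c x) p) w \<noteq> 0" if "Im w > 0" for w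
    using assms that by (simp add: stable2_def eval2_y)
  show thesis
    by (rule log_deriv_upper_half_plane[OF nz assms(3)])
      (auto intro!: that simp: pderiv_map_poly_eval eval2_y)
qed

lemma raising2_add: "raising2 (p + q) = raising2 p + raising2 q"
proof -
  have "pderiv_x (p + q) = pderiv_x p + pderiv_x q"
    by (intro poly_eqI) (simp add: coeff_map_poly pderiv_add)
  then show ?thesis by (simp add: raising2_def pderiv_add smult_add_right)
qed

lemma raising2_smult: "raising2 (smult [:c:] p) = smult [:c:] (raising2 p)"
proof -
  have "pderiv_x (smult [:c:] p) = smult [:c:] (pderiv_x p)"
    by (intro poly_eqI) (simp add: coeff_map_poly pderiv_smult)
  then show ?thesis by (simp add: raising2_def pderiv_smult smult_add_right smult_diff_right mult.commute)
qed

lemma raising2_0 [simp]: "raising2 0 = 0"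
  by (simp add: raising2_def)

lemma raising2_pderiv: "raising2 (pderiv p) = pderiv (raising2 p)"
proof -
  have "pderiv_x (pderiv p) = pderiv (pderiv_x p)"
    by (intro poly_eqI)
      (simp add: coeff_map_poly coeff_pderiv pderiv_mult del: of_nat_Suc)
  then show ?thesis by (simp add: raising2_def pderiv_add pderiv_diff pderiv_smult)
qed

lemma degree_raising2_le: "degree (raising2 p) \<le> degree p"
proof -
  have "degree (pderiv_x p) \<le> degree p"
    by (rule degree_le) (simp add: coeff_map_poly coeff_eq_0)
  moreover have "degree (pderiv p) \<le> degree p" by (rule degree_le) (simp add: coeff_pderiv coeff_eq_0)
  ultimately show ?thesis unfolding raising2_def
    by (intro degree_diff_le degree_add_le order_trans[OF degree_smult_le]) auto
qed

text \<open>On the upper half plane \<open>raising2\<close> multiplies a stable polynomial by a number with positive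
  imaginary part and \<open>pderiv\<close> by one with negative imaginary part, and the product of two such
  numbers is never a negative real. The leading coefficient in \<open>y\<close> stays constant, which rules out
  degenerate points.\<close>

lemma stable2_step:
  assumes st: "stable2 p" and lc: "lead_coeff p = [:c:]" "c \<noteq> 0" and s: "s > 0"
  defines "q \<equiv> smult [:of_real s:] p + num2 p"
  shows "stable2 q" "lead_coeff q = [:of_real s * c:]"
proof -
  have "stable2 q \<and> lead_coeff q = [:of_real s * c:]"
  proof (cases "degree p = 0")
    case True
    then have "pderiv p = 0" by (simp add: pderiv_eq_0_iff)
    then have "q = smult [:of_real s:] p" by (simp add: q_def num2_def)
    then show ?thesis using st lc s by (auto simp: stable2_def eval2_smult mult.commute)
  next
    case False
    have deg: "degree (map_poly (\<lambda>c. poly c x) p) > 0" for x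
    proof -
      have "coeff (map_poly (\<lambda>c. poly c x) p) (degree p) \<noteq> 0" using lc by (simp add: coeff_map_poly)
      then show ?thesis using False le_degree by fastforce
    qed
    have st': "stable2 (pderiv p)" unfolding stable2_def
    proof (intro allI impI)
      fix x y assume xy: "Im x > 0" "Im y > 0"
      obtain l where "eval2 (pderiv p) x y = l * eval2 p x y" "Im l < 0"
        using stable2_log_deriv_y[OF st xy] deg[of x] by auto
      moreover have "eval2 p x y \<noteq> 0" using st xy by (simp add: stable2_def)
      ultimately show "eval2 (pderiv p) x y \<noteq> 0" by auto
    qed
    have "stable2 q" unfolding stable2_def
    proof (intro allI impI notI)
      fix x y assume xy: "Im x > 0" "Im y > 0" and zero: "eval2 q x y = 0"
      obtain l where l: "eval2 (pderiv p) x y = l * eval2 p x y" "Im l < 0"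
        using stable2_log_deriv_y[OF st xy] deg[of x] by auto
      obtain l1 where l1: "eval2 (pderiv_x (pderiv p)) x y = l1 * eval2 (pderiv p) x y" "Im l1 \<le> 0"
        using stable2_log_deriv_x[OF st' xy] .
      obtain l2 where l2: "eval2 (pderiv (pderiv p)) x y = l2 * eval2 (pderiv p) x y" "Im l2 \<le> 0"
        using stable2_log_deriv_y[OF st' xy] by auto
      define k where "k = x - (l1 + l2) / 2"
      have k: "Im k > 0" using xy l1 l2 by (simp add: k_def)
      have "eval2 q x y = (of_real s + k * l) * eval2 p x y"
        unfolding q_def num2_def eval2_add eval2_smult eval2_raising2 l1 l2 l
        by (simp add: k_def algebra_simps)
      then have "of_real s + k * l = 0" using zero st xy by (simp add: stable2_def)
      moreover have "l \<noteq> 0" using l by auto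
      ultimately have kl: "k = of_real s * (1 / (- l))" by (simp add: field_simps add_eq_0_iff)
      have "Im (1 / (- l)) < 0" by (rule Im_inverse_neg) (use l in simp)
      moreover have "Im k = s * Im (1 / (- l))"
        by (subst kl) (simp only: times_complex.sel Re_complex_of_real Im_complex_of_real
            mult_zero_left add_0_right)
      ultimately have "Im k < 0" using s by (simp add: mult_pos_neg)
      then show False using k by simp
    qed
    moreover have "lead_coeff q = [:of_real s * c:]"
    proof -
      \<comment> \<open>\<open>num2\<close> lowers the degree in \<open>y\<close>, so only the
        summand with \<open>s\<close> reaches the leading coefficient.\<close>
      have "degree (num2 p) < degree p"
        using degree_raising2_le[of "pderiv p"] False by (simp add: num2_def degree_pderiv)
      then have co: "coeff (num2 p) i = 0" if "i \<ge> degree p" for i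
        using that by (intro coeff_eq_0) linarith
      have top: "coeff q (degree p) = [:of_real s * c:]"
        using lc co by (simp add: q_def)
      have "degree q \<le> degree p"
        by (rule degree_le) (simp add: q_def co coeff_eq_0)
      moreover have "degree q \<ge> degree p" using top lc s by (intro le_degree) simp
      ultimately show ?thesis using top by simp
    qed
    ultimately show ?thesis by simp
  qed
  then show "stable2 q" "lead_coeff q = [:of_real s * c:]" by auto
qed

section \<open>Products of first-order factors in the operator \<open>num2\<close>\<close>

fun num2_prod :: "real list \<Rightarrow> complex poly poly \<Rightarrow> complex poly poly" where
  "num2_prod [] p = p"
| "num2_prod (s # ss) p = smult [:of_real s:] (num2_prod ss p) + num2 (num2_prod ss p)"

lemma stable2_num2_prod:
  assumes "stable2 p" "lead_coeff p = [:c:]" "c \<noteq> 0" "\<forall>s\<in>set ss. s > 0"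
  shows "stable2 (num2_prod ss p) \<and> (\<exists>c. c \<noteq> 0 \<and> lead_coeff (num2_prod ss p) = [:c:])"
  using assms(4)
proof (induction ss)
  case Nil
  then show ?case using assms by simp
next
  case (Cons s ss)
  then obtain d where d: "stable2 (num2_prod ss p)" "lead_coeff (num2_prod ss p) = [:d:]" "d \<noteq> 0" "s > 0"
    by auto
  show ?case using stable2_step[OF d] d by (intro conjI exI[of _ "of_real s * d"]) auto
qed

abbreviation linear_prod :: "real list \<Rightarrow> real poly" where
  "linear_prod ss \<equiv> (\<Prod>s\<leftarrow>ss. [:s, 1:])"

lemma degree_linear_prod: "degree (linear_prod ss) = length ss"
proof -
  have "degree (linear_prod ss) = length ss \<and> linear_prod ss \<noteq> 0"
    by (induction ss) (auto simp: degree_mult_eq simp del: mult_pCons_left)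
  then show ?thesis by simp
qed

lemma coeff_linear_mult:
  "coeff ([:s, 1:] * p) k = s * coeff p k + (if k = 0 then 0 else coeff p (k - 1))" for s :: real
  by (cases k) (auto simp: coeff_pCons)

lemma num2_add: "num2 (p + q) = num2 p + num2 q"
  by (simp add: num2_def pderiv_add raising2_add)

lemma num2_smult: "num2 (smult [:c:] p) = smult [:c:] (num2 p)"
  by (simp add: num2_def pderiv_smult raising2_smult)

lemma num2_0 [simp]: "num2 0 = 0"
  by (simp add: num2_def)

lemma num2_sum: "num2 (sum f A) = (\<Sum>x\<in>A. num2 (f x))"
  by (induction A rule: infinite_finite_induct) (simp_all add: num2_add)

lemma smult_sum_right: "smult c (sum f A) = (\<Sum>x\<in>A. smult c (f x))"
  by (induction A rule: infinite_finite_induct) (simp_all add: smult_add_right)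

text \<open>The factors are polynomials in a single operator with constant coefficients, so they
  multiply like the linear polynomials \<open>[:s, 1:]\<close>.\<close>

lemma num2_prod_expand:
  "num2_prod ss p = (\<Sum>k\<le>length ss. smult [:of_real (coeff (linear_prod ss) k):] ((num2 ^^ k) p))"
proof (induction ss)
  case (Cons s ss)
  let ?n = "length ss" and ?Q = "linear_prod ss"
  let ?t = "\<lambda>a k. smult [:complex_of_real a:] ((num2 ^^ k) p)"
  have top: "coeff ?Q (Suc ?n) = 0" by (intro coeff_eq_0) (simp add: degree_linear_prod)
  have "(\<Sum>k\<le>Suc ?n. ?t (coeff ([:s, 1:] * ?Q) k) k)
      = (\<Sum>k\<le>Suc ?n. ?t (s * coeff ?Q k) k) + (\<Sum>k\<le>Suc ?n. ?t (if k = 0 then 0 else coeff ?Q (k - 1)) k)"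
    unfolding coeff_linear_mult sum.distrib[symmetric]
    by (intro sum.cong refl) (simp add: smult_add_left[symmetric])
  also have "(\<Sum>k\<le>Suc ?n. ?t (s * coeff ?Q k) k) = smult [:of_real s:] (num2_prod ss p)"
    unfolding Cons.IH smult_sum_right by (simp add: top mult.commute)
  also have "(\<Sum>k\<le>Suc ?n. ?t (if k = 0 then 0 else coeff ?Q (k - 1)) k) = num2 (num2_prod ss p)"
    unfolding Cons.IH num2_sum by (subst sum.atMost_Suc_shift) (simp add: num2_smult)
  finally show ?case by (simp del: mult_pCons_left)
qed (simp flip: one_pCons)

text \<open>The gain from the second variable: commutation turns powers of the product into normally
  ordered monomials.\<close>

lemma num2_pow: "(num2 ^^ k) p = (raising2 ^^ k) ((pderiv ^^ k) p)"
proof (induction k)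
  case (Suc k)
  have comm: "pderiv ((raising2 ^^ k) q) = (raising2 ^^ k) (pderiv q)" for q
    by (induction k) (simp_all add: raising2_pderiv[symmetric])
  show ?case using Suc by (simp add: num2_def comm)
qed simp

section \<open>Restriction to the diagonal\<close>

abbreviation diag :: "complex poly poly \<Rightarrow> complex poly" where
  "diag p \<equiv> poly p [:0, 1:]"

lemma pderiv_diag: "pderiv (diag p) = diag (pderiv_x p) + diag (pderiv p)"
  by (induction p) (auto simp: map_poly_pCons pderiv_add pderiv_pCons algebra_simps)

lemma diag_raising2: "diag (raising2 p) = raising (diag p)"
  by (simp add: raising2_def raising_def pderiv_diag smult_add_right)

lemma diag_raising2_pow: "diag ((raising2 ^^ k) p) = (raising ^^ k) (diag p)"
  by (induction k) (simp_all add: diag_raising2)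

lemma poly_diag: "poly (diag p) x = eval2 p x x"
  unfolding eval2_def by (induction p) auto

abbreviation lift_y :: "complex poly \<Rightarrow> complex poly poly" where
  "lift_y f \<equiv> map_poly (\<lambda>c. [:c:]) f"

lemma diag_lift_y: "diag (lift_y f) = f"
  by (induction f) (auto simp: map_poly_pCons)

lemma eval2_lift_y: "eval2 (lift_y f) x y = poly f y"
  unfolding eval2_def by (induction f) (auto simp: map_poly_pCons)

lemma pderiv_lift_y: "pderiv (lift_y f) = lift_y (pderiv f)"
  by (intro poly_eqI) (simp add: coeff_pderiv coeff_map_poly of_nat_poly mult.commute)

lemma pderiv_pow_lift_y: "(pderiv ^^ k) (lift_y f) = lift_y ((pderiv ^^ k) f)"
  by (induction k) (simp_all add: pderiv_lift_y)

lemma cpoly_pow: "cpoly ((raising ^^ k) p) = (raising ^^ k) (cpoly p)"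
    "cpoly ((pderiv ^^ k) p) = (pderiv ^^ k) (cpoly p)"
  by (induction k) (simp_all add: cpoly_raising)

lemma cpoly_normal_op:
  "cpoly (normal_op (length ss) (coeff (linear_prod ss)) f) = diag (num2_prod ss (lift_y (cpoly f)))"
  unfolding normal_op_def num2_prod_expand num2_pow pderiv_pow_lift_y poly_sum
  by (simp add: diag_raising2_pow diag_lift_y cpoly_pow)

lemma normal_op_linear_prod_pos:
  assumes f: "real_rooted f" and ss: "\<forall>s\<in>set ss. s > 0"
  shows "real_rooted (normal_op (length ss) (coeff (linear_prod ss)) f)"
proof (cases "f = 0")
  case False
  have "stable2 (lift_y (cpoly f))"
    using f False by (auto simp: stable2_def eval2_lift_y real_rooted_iff_upper_half_plane)
  moreover have "lead_coeff (lift_y (cpoly f)) = [:of_real (lead_coeff f):]"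
    by (simp add: degree_map_poly coeff_map_poly)
  ultimately have "stable2 (num2_prod ss (lift_y (cpoly f)))"
    using stable2_num2_prod[OF _ _ _ ss] False by simp
  then show ?thesis
    by (auto simp: real_rooted_iff_upper_half_plane cpoly_normal_op poly_diag stable2_def)
next
  case True
  have "normal_op n F 0 = 0" for n F using normal_op_smult[of n F 0 0] by simp
  then show ?thesis using True by simp
qed

lemma normal_op_degree_eq:
  assumes "degree f \<le> n"
  shows "normal_op n F f = normal_op (degree f) F f"
proof -
  have "(raising ^^ k) ((pderiv ^^ k) f) = 0" if "k > degree f" for k
  proof -
    have "(pderiv ^^ k) f = 0"
      using that by (intro poly_eqI) (simp add: coeff_higher_pderiv coeff_eq_0)
    moreover have "(raising ^^ k) (0::real poly) = 0" for k by (induction k) auto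
    ultimately show ?thesis by simp
  qed
  then show ?thesis unfolding normal_op_def using assms
    by (intro sum.mono_neutral_right) auto
qed

lemma normal_op_coeff_eq:
  assumes "degree Q \<le> n"
  shows "normal_op n (coeff Q) f = normal_op (degree f) (coeff Q) f"
proof -
  let ?m = "max n (degree f)"
  have "normal_op ?m (coeff Q) f = normal_op n (coeff Q) f"
    unfolding normal_op_def using assms
    by (intro sum.mono_neutral_right) (auto simp: coeff_eq_0)
  then show ?thesis using normal_op_degree_eq[of f ?m] by simp
qed

lemma normal_op_limit:
  assumes F: "F \<noteq> bot" and rr: "\<forall>\<^sub>F x in F. real_rooted (normal_op n (c x) f)"
    and lim: "\<And>k. ((\<lambda>x. c x k) \<longlongrightarrow> d k) F"
  shows "real_rooted (normal_op n d f)"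
proof -
  define u where "u k = (raising ^^ k) ((pderiv ^^ k) f)" for k
  have eq: "normal_op n e f = (\<Sum>k\<le>n. smult (e k) (u k))" for e
    by (simp add: normal_op_def u_def)
  have "degree (normal_op n e f) \<le> (\<Sum>k\<le>n. degree (u k))" for e
    unfolding eq by (intro degree_sum_le order_trans[OF degree_smult_le] member_le_sum) auto
  moreover have "((\<lambda>x. coeff (normal_op n (c x) f) k) \<longlongrightarrow> coeff (normal_op n d f) k) F" for k
    unfolding eq coeff_sum coeff_smult by (intro tendsto_intros lim)
  ultimately show ?thesis using F rr by (intro real_rooted_limit[of F])
qed

text \<open>Vanishing parameters are reached by shifting all of them by \<open>e > 0\<close> and
  letting \<open>e\<close> tend to \<open>0\<close>.\<close>

lemma normal_op_linear_prod:
  assumes f: "real_rooted f" and ss: "\<forall>s\<in>set ss. s \<ge> 0"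
  shows "real_rooted (normal_op (degree f) (coeff (linear_prod ss)) f)"
proof (rule normal_op_limit[of "at_right 0" _ "\<lambda>e. coeff (linear_prod (map (\<lambda>s. s + e) ss))"])
  have "real_rooted (normal_op (degree f) (coeff (linear_prod (map (\<lambda>s. s + e) ss))) f)" if "e > 0" for e
  proof -
    have "\<forall>s\<in>set (map (\<lambda>s. s + e) ss). s > 0" using ss that by (auto simp: add_nonneg_pos)
    then show ?thesis
      using normal_op_linear_prod_pos[OF f] normal_op_coeff_eq degree_linear_prod by (metis order_refl)
  qed
  then show "\<forall>\<^sub>F e in at_right 0. real_rooted (normal_op (degree f) (coeff (linear_prod (map (\<lambda>s. s + e) ss))) f)"
    by (intro eventually_at_rightI[of 0 1]) auto
  show "((\<lambda>e. coeff (linear_prod (map (\<lambda>s. s + e) ss)) k) \<longlongrightarrow> coeff (linear_prod ss) k) (at_right 0)" for k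
  proof (induction ss arbitrary: k)
    case (Cons s ss)
    have "((\<lambda>e. (s + e) * coeff (linear_prod (map (\<lambda>s. s + e) ss)) k
            + (if k = 0 then 0 else coeff (linear_prod (map (\<lambda>s. s + e) ss)) (k - 1)))
        \<longlongrightarrow> (s + 0) * coeff (linear_prod ss) k + (if k = 0 then 0 else coeff (linear_prod ss) (k - 1))) (at_right 0)"
      using Cons.IH[of "k - 1"] by (intro tendsto_intros Cons.IH) auto
    then show ?case by (simp only: list.map prod_list.Cons coeff_linear_mult add_0_right)
  qed simp
qed (simp add: trivial_limit_at_right_real)

lemma real_rooted_nonneg_coeffs_factor:
  assumes "real_rooted Q" "Q \<noteq> 0" "\<And>k. coeff Q k \<ge> 0"
  obtains c ss where "Q = smult c (linear_prod ss)" "\<forall>s\<in>set ss. s \<ge> 0"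
proof -
  have nonpos: "r \<le> 0" if "poly Q r = 0" for r
  proof (rule ccontr)
    assume r: "\<not> r \<le> 0"
    have "coeff Q k * r ^ k = 0" if "k \<le> degree Q" for k
      using \<open>poly Q r = 0\<close> that r assms(3) unfolding poly_altdef
      by (subst (asm) sum_nonneg_eq_0_iff) auto
    then have "lead_coeff Q * r ^ degree Q = 0" by blast
    then show False using r assms(2) by auto
  qed
  have "\<exists>c ss. Q = smult c (linear_prod ss) \<and> (\<forall>s\<in>set ss. s \<ge> 0)"
    using assms(1,2) nonpos
  proof (induction "degree Q" arbitrary: Q)
    case 0
    then obtain c where "Q = [:c:]" by (metis degree_eq_zeroE)
    then show ?case by (intro exI[of _ c] exI[of _ "[]"]) simp
  next
    case (Suc n)
    have "\<not> constant (poly (cpoly Q))" using Suc.hyps(2) by (simp add: constant_degree)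
    then obtain z where z: "poly (cpoly Q) z = 0" using fundamental_theorem_of_algebra by blast
    then have "Im z = 0" using real_rooted_imp_Im_eq_0 Suc.prems by blast
    then have zr: "z = of_real (Re z)" by (simp add: complex_eq_iff)
    define r where "r = Re z"
    have "of_real (poly Q r) = (0::complex)" using z zr unfolding r_def by (metis poly_cpoly_of_real)
    then have r: "poly Q r = 0" by simp
    then obtain P where P: "Q = [:-r, 1:] * P" by (metis poly_eq_0_iff_dvd dvdE)
    have "P \<noteq> 0" using P Suc.prems by auto
    moreover have "degree Q = Suc (degree P)"
      unfolding P using \<open>P \<noteq> 0\<close> by (subst degree_mult_eq) auto
    moreover have "real_rooted P"
      using Suc.prems(1,2) unfolding P by (auto simp: real_rooted_iff_upper_half_plane simp del: mult_pCons_left)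
    moreover have "x \<le> 0" if "poly P x = 0" for x
      using Suc.prems(3)[of x] that unfolding P by simp
    ultimately obtain c ss where css: "P = smult c (linear_prod ss)" "\<forall>s\<in>set ss. s \<ge> 0"
      using Suc.hyps(1)[of P] Suc.hyps(2) by auto
    have "Q = smult c (linear_prod (- r # ss))"
      unfolding P css(1) list.map prod_list.Cons mult_smult_right ..
    moreover have "- r \<ge> 0" using Suc.prems(3)[OF r] by simp
    ultimately show ?case using css(2) by (intro exI[of _ c] exI[of _ "- r # ss"]) auto
  qed
  then show thesis by (elim exE conjE) (rule that)
qed

lemma normal_op_real_rooted:
  assumes "real_rooted f" "real_rooted Q" "\<And>k. coeff Q k \<ge> 0"
  shows "real_rooted (normal_op (degree f) (coeff Q) f)"
proof (cases "Q = 0")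
  case True
  then show ?thesis by (simp add: normal_op_def)
next
  case False
  obtain c ss where css: "Q = smult c (linear_prod ss)" "\<forall>s\<in>set ss. s \<ge> 0"
    using real_rooted_nonneg_coeffs_factor[OF assms(2) False assms(3)] .
  have "normal_op (degree f) (coeff Q) f = smult c (normal_op (degree f) (coeff (linear_prod ss)) f)"
    unfolding normal_op_def css(1) smult_sum_right by simp
  then show ?thesis using normal_op_linear_prod[OF assms(1) css(2)] by (simp add: real_rooted_smult)
qed

section \<open>Sufficiency: from Jensen polynomials to the full operator\<close>

lemma binomial_over_power_tendsto: "(\<lambda>n. real (n choose k) / real n ^ k) \<longlonglongrightarrow> 1 / fact k"
proof (induction k)
  case (Suc k)
  have "(\<lambda>n. real (n choose k) / real n ^ k * ((1 - real k * (1 / real n)) / real (Suc k)))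
      \<longlonglongrightarrow> 1 / fact k * ((1 - real k * 0) / real (Suc k))"
    by (intro tendsto_intros Suc.IH lim_1_over_n) simp
  moreover have "\<forall>\<^sub>F n in sequentially. real (n choose k) / real n ^ k * ((1 - real k * (1 / real n)) / real (Suc k))
      = real (n choose Suc k) / real n ^ Suc k"
    using eventually_gt_at_top[of k]
  proof eventually_elim
    case (elim n)
    have "(n choose k) * (n - k) = Suc k * (n choose Suc k)"
      using binomial_absorb_comp[of n k] binomial_absorption[of k n] by (simp add: mult.commute)
    then have "real (n choose k) * real (n - k) = real (Suc k) * real (n choose Suc k)"
      by (metis of_nat_mult)
    then have eq: "real (n choose Suc k) = real (n choose k) * (real n - real k) / real (Suc k)"
      using elim by (simp add: of_nat_diff field_simps del: of_nat_Suc)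
    have alg: "C / N ^ k * ((1 - K * (1 / N)) / S) = C * (N - K) / S / N ^ Suc k"
      if "N \<noteq> 0" "S \<noteq> 0" for C N K S :: real
      using that by (simp add: field_simps)
    show ?case unfolding eq by (rule alg) (use elim in auto)
  qed
  ultimately show ?case by (simp add: tendsto_cong mult.commute)
qed simp

lemma hermite_multiplier_sequenceI:
  assumes lam: "jensen_real_rooted lam" "\<And>n. lam n \<ge> 0" "\<And>n. lam n \<le> lam (Suc n)"
  shows "hermite_multiplier_sequence lam"
  unfolding hermite_multiplier_sequence_def
proof (intro allI impI)
  fix f assume f: "real_rooted f"
  \<comment> \<open>Rescaling by \<open>1 / n\<close> replaces the binomial coefficients by
    \<open>(n choose k) / n^k\<close>, which tend to \<open>1 / fact k\<close>.\<close>
  define Q where "Q n = pcompose (jensen (\<lambda>k. (fwd_diff ^^ k) lam 0) n) [:0, 1 / real n:]" for n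
  have coeffQ: "coeff (Q n) k = real (n choose k) / real n ^ k * (fwd_diff ^^ k) lam 0" for n k
    by (simp add: Q_def coeff_pcompose_linear coeff_jensen power_divide)
  have "real_rooted (Q n)" for n
    unfolding Q_def by (intro real_rooted_scale real_rooted_jensen_fwd_diff lam)
  moreover have "coeff (Q n) k \<ge> 0" for n k
    using fwd_diff_pow_nonneg[OF lam] by (simp add: coeffQ)
  ultimately have "real_rooted (normal_op (degree f) (coeff (Q n)) f)" for n
    using f by (intro normal_op_real_rooted)
  moreover have "(\<lambda>n. coeff (Q n) k) \<longlonglongrightarrow> 1 / fact k * (fwd_diff ^^ k) lam 0" for k
    unfolding coeffQ by (intro tendsto_intros binomial_over_power_tendsto)
  ultimately have "real_rooted (normal_op (degree f) (\<lambda>k. (fwd_diff ^^ k) lam 0 / fact k) f)"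
    by (intro normal_op_limit[of sequentially _ "\<lambda>n. coeff (Q n)"]) auto
  then show "real_rooted (hermite_op lam f)" by (simp add: hermite_op_eq_normal_op[OF order_refl])
qed

section \<open>Necessity\<close>

lemma coeff_classical_op: "coeff (classical_op lam p) j = lam j * coeff p j"
proof -
  have "coeff (classical_op lam p) j = (\<Sum>k\<le>degree p. if k = j then lam j * coeff p j else 0)"
    unfolding classical_op_def coeff_sum by (intro sum.cong) auto
  then show ?thesis by (auto simp: sum.delta' coeff_eq_0)
qed

text \<open>The rescaled polynomials \<open>(e/2)^n hermite n (x / e)\<close> tend to \<open>x^n\<close> as \<open>e\<close> tends to \<open>0\<close>.\<close>

lemma hermite_multiplier_sequence_imp_multiplier_sequence:
  assumes "hermite_multiplier_sequence lam"
  shows "multiplier_sequence lam"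
  unfolding multiplier_sequence_def
proof (intro allI impI)
  fix p assume p: "real_rooted p"
  define d where "d = degree p"
  define t where "t k = hermite_op lam (monom 1 k)" for k
  define q where "q e = pcompose (hermite_op lam (pcompose p [:0, e:])) [:0, 1 / e:]" for e
  have t: "coeff (t k) k = lam k" "k < j \<Longrightarrow> coeff (t k) j = 0" for k j
  proof -
    have deg: "degree (monom (1::real) k) \<le> k" by (simp add: degree_monom_eq)
    show "coeff (t k) k = lam k" unfolding t_def by (subst coeff_hermite_op_top[OF deg]) simp
    show "coeff (t k) j = 0" if "k < j"
      using degree_hermite_op_le[OF deg, of lam] that unfolding t_def by (intro coeff_eq_0) linarith
  qed
  have op: "hermite_op lam (pcompose p [:0, e:]) = (\<Sum>k\<le>d. smult (e ^ k * coeff p k) (t k))" for e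
  proof -
    have "pcompose p [:0, e:] = (\<Sum>k\<le>d. smult (e ^ k * coeff p k) (monom 1 k))"
    proof (intro poly_eqI)
      fix j
      have "coeff (\<Sum>k\<le>d. smult (e ^ k * coeff p k) (monom 1 k)) j
          = (\<Sum>k\<le>d. if k = j then e ^ j * coeff p j else 0)"
        unfolding coeff_sum by (intro sum.cong) auto
      then show "coeff (pcompose p [:0, e:]) j = coeff (\<Sum>k\<le>d. smult (e ^ k * coeff p k) (monom 1 k)) j"
        by (auto simp: coeff_pcompose_linear d_def coeff_eq_0)
    qed
    then show ?thesis by (simp add: hermite_op_sum hermite_op_smult t_def)
  qed
  \<comment> \<open>The contribution of \<open>x^k\<close> to coefficient \<open>j\<close>. It is
    zero for \<open>k < j\<close>, where natural subtraction would mislead, and for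
    \<open>k > j\<close> the power of \<open>e\<close> kills it in the limit.\<close>
  define h where "h j k e = (if k < j then 0 else e ^ (k - j) * (coeff p k * coeff (t k) j))" for j k and e :: real
  have coeff_q: "coeff (q e) j = (\<Sum>k\<le>d. h j k e)" if "e > 0" for e j
  proof -
    have "coeff (q e) j = (\<Sum>k\<le>d. (1 / e) ^ j * (e ^ k * coeff p k * coeff (t k) j))"
      by (simp add: q_def coeff_pcompose_linear op coeff_sum sum_distrib_left)
    also have "\<dots> = (\<Sum>k\<le>d. h j k e)"
    proof (intro sum.cong refl)
      fix k
      show "(1 / e) ^ j * (e ^ k * coeff p k * coeff (t k) j) = h j k e"
        using that t(2)[of k j] by (simp add: h_def power_diff power_divide)
    qed
    finally show ?thesis .
  qed
  have h_lim: "(h j k \<longlongrightarrow> (if k = j then lam j * coeff p j else 0)) (at_right 0)" for j k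
  proof -
    have "((\<lambda>e. e ^ (k - j) * (coeff p k * coeff (t k) j))
        \<longlongrightarrow> 0 ^ (k - j) * (coeff p k * coeff (t k) j)) (at_right (0::real))"
      by (intro tendsto_intros)
    then show ?thesis using t(1)[of k]
      by (cases "k < j"; cases "k = j") (auto simp: h_def[abs_def] mult.commute power_0_left)
  qed
  have sum_h_lim: "((\<lambda>e. \<Sum>k\<le>d. h j k e) \<longlongrightarrow> coeff (classical_op lam p) j) (at_right 0)" for j
  proof -
    have "((\<lambda>e. \<Sum>k\<le>d. h j k e) \<longlongrightarrow> (\<Sum>k\<le>d. if k = j then lam j * coeff p j else 0)) (at_right 0)"
      by (intro tendsto_sum h_lim)
    moreover have "(\<Sum>k\<le>d. if k = j then lam j * coeff p j else 0) = coeff (classical_op lam p) j"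
      by (simp add: coeff_classical_op d_def coeff_eq_0)
    ultimately show ?thesis by simp
  qed
  show "real_rooted (classical_op lam p)"
  proof (rule real_rooted_limit[of "at_right 0" q d])
    show "at_right (0::real) \<noteq> bot" by (simp add: trivial_limit_at_right_real)
    show "\<forall>\<^sub>F e in at_right 0. real_rooted (q e)"
      using assms p unfolding q_def hermite_multiplier_sequence_def
      by (intro always_eventually allI real_rooted_scale) (auto intro: real_rooted_scale)
    show "degree (q e) \<le> d" for e
    proof -
      have "degree (pcompose p [:0, e:]) \<le> d"
        using degree_pcompose_le[of p "[:0, e:]"] by (auto simp: d_def split: if_splits)
      then have "degree (hermite_op lam (pcompose p [:0, e:])) \<le> d" by (rule degree_hermite_op_le)
      then show ?thesis unfolding q_def
        using degree_pcompose_le[of "hermite_op lam (pcompose p [:0, e:])" "[:0, 1 / e:]"]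
        by (auto split: if_splits)
    qed
    show "((\<lambda>e. coeff (q e) j) \<longlongrightarrow> coeff (classical_op lam p) j) (at_right 0)" for j
    proof -
      have "\<forall>\<^sub>F e in at_right 0. coeff (q e) j = (\<Sum>k\<le>d. h j k e)"
        by (rule eventually_at_rightI[of 0 1]) (auto intro: coeff_q)
      then show ?thesis using sum_h_lim[of j] by (simp add: tendsto_cong)
    qed
  qed
qed

section \<open>Hermite polynomials on the imaginary axis\<close>

fun hermite_im :: "nat \<Rightarrow> real \<Rightarrow> real" where
  "hermite_im 0 y = 1"
| "hermite_im (Suc 0) y = 2 * y"
| "hermite_im (Suc (Suc n)) y = 2 * y * hermite_im (Suc n) y + 2 * real (Suc n) * hermite_im n y"

text \<open>Substituting \<open>x = i y\<close> flips the minus sign of the recurrence, which makes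
  \<open>hermite_im\<close> nonnegative for \<open>y >= 0\<close>.\<close>

lemma hermite_imaginary_axis:
  "poly (cpoly (hermite n)) (\<i> * of_real y) = \<i> ^ n * of_real (hermite_im n y)"
  by (induction n rule: hermite.induct) (simp_all add: algebra_simps)

lemma hermite_im_nonneg: "y \<ge> 0 \<Longrightarrow> hermite_im n y \<ge> 0"
  by (induction n y rule: hermite_im.induct) auto

lemma hermite_im_pos: "y > 0 \<Longrightarrow> hermite_im n y > 0"
  by (induction n y rule: hermite_im.induct) (auto intro!: add_pos_nonneg mult_pos_pos)

lemma hermite_im_0_pos: "even n \<Longrightarrow> hermite_im n 0 > 0"
  by (induction n "0::real" rule: hermite_im.induct) auto

lemma continuous_on_hermite_im: "continuous_on A (hermite_im n)"
proof (induction n rule: hermite.induct)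
  case 1
  then show ?case by simp
next
  case 2
  have "hermite_im (Suc 0) = (\<lambda>y. 2 * y)" by auto
  then show ?case by (simp add: continuous_intros)
next
  case (3 n)
  have "hermite_im (Suc (Suc n)) = (\<lambda>y. 2 * y * hermite_im (Suc n) y + 2 * real (Suc n) * hermite_im n y)"
    by auto
  then show ?case using 3 by (simp only:) (intro continuous_intros)
qed

text \<open>Up to a power of \<open>i\<close> the polynomial is real on the imaginary axis. It
  changes sign between \<open>y0\<close> and a large \<open>y\<close>, so it has a root there away
  from \<open>0\<close>.\<close>

lemma not_real_rooted_hermite_add:
  assumes y0: "y0 \<ge> 0" and less: "hermite_im (n + 2) y0 < c * hermite_im n y0"
  shows "\<not> real_rooted (hermite (n + 2) + smult c (hermite n))"
proof
  assume rr: "real_rooted (hermite (n + 2) + smult c (hermite n))"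
  define g where "g y = hermite_im (n + 2) y - c * hermite_im n y" for y
  \<comment> \<open>Large enough for \<open>c <= 4 * y1^2\<close>; two steps of the recurrence give
    \<open>hermite_im (n + 2) y1 >= 4 * y1^2 * hermite_im n y1\<close>.\<close>
  define y1 where "y1 = max (y0 + 1) (c + 1)"
  have y1: "y1 \<ge> 1" "y1 > c" "y1 > y0" using y0 by (auto simp: y1_def)
  have "g y1 \<ge> 0"
  proof -
    have Suc: "2 * y1 * hermite_im k y1 \<le> hermite_im (Suc k) y1" for k
      using y1 hermite_im_nonneg[of y1] by (cases k) auto
    have "y1 * 1 \<le> y1 * y1" using y1 by (intro mult_left_mono) auto
    then have "c \<le> 2 * y1 * (2 * y1)" using y1 by linarith
    then have "c * hermite_im n y1 \<le> 2 * y1 * (2 * y1) * hermite_im n y1"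
      using y1 hermite_im_nonneg[of y1] by (intro mult_right_mono) auto
    also have "\<dots> = 2 * y1 * (2 * y1 * hermite_im n y1)" by (simp add: mult_ac)
    also have "\<dots> \<le> 2 * y1 * hermite_im (Suc n) y1"
      using y1 by (intro mult_left_mono Suc) auto
    also have "\<dots> \<le> hermite_im (Suc (Suc n)) y1" by (rule Suc)
    finally show ?thesis by (simp add: g_def)
  qed
  moreover have "g y0 < 0" using less by (simp add: g_def)
  moreover have "continuous_on {y0..y1} g"
    unfolding g_def by (intro continuous_intros continuous_on_hermite_im)
  ultimately obtain y where y: "y0 \<le> y" "g y = 0"
    using IVT'[of g y0 0 y1] y1 by auto
  have "y > 0" using y \<open>g y0 < 0\<close> y0 by (cases "y = y0") auto
  have "poly (cpoly (hermite (n + 2) + smult c (hermite n))) (\<i> * of_real y)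
      = - (\<i> ^ n * of_real (g y))"
    unfolding cpoly_add cpoly_smult poly_add poly_smult hermite_imaginary_axis
    by (simp add: g_def algebra_simps del: hermite_im.simps)
  then have root: "poly (cpoly (hermite (n + 2) + smult c (hermite n))) (\<i> * of_real y) = 0"
    using y by simp
  have "coeff (hermite (n + 2) + smult c (hermite n)) (n + 2) = 2 ^ (n + 2)"
    using degree_hermite_le[of n] coeff_hermite_self[of "n + 2"]
    by (simp add: coeff_eq_0 del: hermite.simps)
  then have "hermite (n + 2) + smult c (hermite n) \<noteq> 0" by (metis coeff_0 power_not_zero zero_neq_numeral)
  then have "Im (\<i> * of_real y) = 0" using real_rooted_imp_Im_eq_0[OF rr _ root] by simp
  then show False using \<open>y > 0\<close> by simp
qed

lemma X_mult_hermite: "[:0, 2:] * hermite (Suc n) = hermite (n + 2) + smult (2 * real (Suc n)) (hermite n)"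
  by simp

text \<open>Before the operator acts, \<open>2 x * hermite (Suc n)\<close> vanishes at
  \<open>0\<close>. A drop in \<open>lam\<close> enlarges the relative weight of
  \<open>hermite n\<close>, and for even \<open>n\<close> its value at \<open>0\<close> is nonzero,
  so the sign condition holds at \<open>y0 = 0\<close>.\<close>

lemma hermite_multiplier_even_step:
  assumes T: "hermite_multiplier_sequence lam" and "even n" and pos: "lam (n + 2) > 0"
  shows "lam n \<le> lam (n + 2)"
proof (rule ccontr)
  assume gt: "\<not> lam n \<le> lam (n + 2)"
  define c where "c = 2 * real (Suc n) * lam n / lam (n + 2)"
  have "real_rooted (hermite_op lam ([:0, 2:] * hermite (Suc n)))"
    using T real_rooted_mult[OF real_rooted_linear real_rooted_hermite]
    unfolding hermite_multiplier_sequence_def by blast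
  also have "hermite_op lam ([:0, 2:] * hermite (Suc n))
      = smult (lam (n + 2)) (hermite (n + 2) + smult c (hermite n))"
    unfolding X_mult_hermite hermite_op_add hermite_op_smult hermite_op_hermite
    using pos by (simp add: c_def smult_add_right mult_ac del: hermite.simps of_nat_Suc)
  finally have "real_rooted (hermite (n + 2) + smult c (hermite n))" using pos by simp
  moreover have "hermite_im (n + 2) 0 < c * hermite_im n 0"
  proof -
    have "2 * real (Suc n) < c" using gt pos by (simp add: c_def pos_less_divide_eq)
    then show ?thesis using hermite_im_0_pos[OF \<open>even n\<close>] by simp
  qed
  ultimately show False using not_real_rooted_hermite_add[of 0] by auto
qed

text \<open>In the Hermite expansion of \<open>(x\<^sup>2 - s) hermite (n + 2)\<close> the coefficient of \<open>hermite (n + 2)\<close>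
  can be made arbitrarily small compared with that of \<open>hermite n\<close>.\<close>

lemma hermite_multiplier_no_cutoff:
  assumes T: "hermite_multiplier_sequence lam" and pos: "lam n > 0" "lam (n + 2) > 0"
  shows "lam (n + 4) \<noteq> 0"
proof
  assume zero: "lam (n + 4) = 0"
  define X where "X = 4 * real (Suc (Suc n)) * real (Suc n) * lam n / lam (n + 2)"
  \<comment> \<open>\<open>c > X\<close> gives \<open>d < 1\<close>, hence \<open>s >= 0\<close>, so
    that \<open>x^2 - s\<close> is real-rooted; the quotient makes \<open>c\<close> large enough for
    the sign condition at \<open>y0 = 1\<close>. The choice of \<open>s\<close> leaves
    \<open>d\<close> as coefficient of \<open>hermite (n + 2)\<close>.\<close>
  define c where "c = hermite_im (n + 2) 1 / hermite_im n 1 + 1 + X"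
  define d where "d = X / c"
  define s where "s = (4 * real n + 10 - d) / 4"
  have X: "X > 0" using pos by (simp add: X_def)
  have im: "hermite_im n 1 > 0" "hermite_im (n + 2) 1 > 0" by (simp_all only: hermite_im_pos zero_less_one)
  have c: "c > X" "c > hermite_im (n + 2) 1 / hermite_im n 1"
    using X im by (auto simp: c_def add_pos_nonneg simp del: hermite_im.simps)
  have d: "d > 0" "d \<le> 1" using X c by (auto simp: d_def)
  have s: "s \<ge> 0" using d by (simp add: s_def)
  define f where "f = [:0, 2:] * ([:0, 2:] * hermite (Suc (Suc n))) - smult (4 * s) (hermite (n + 2))"
  have f: "f = hermite (n + 4) + smult d (hermite (n + 2)) + smult (4 * real (Suc (Suc n)) * real (Suc n)) (hermite n)"
  proof -
    have "[:0, 2:] * ([:0, 2:] * hermite (Suc (Suc n)))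
       = [:0, 2:] * hermite (Suc (n + 2)) + smult (2 * real (Suc (Suc n))) ([:0, 2:] * hermite (Suc n))"
      by (subst X_mult_hermite) (simp only: distrib_left mult_smult_right add_2_eq_Suc' add_Suc_right)
    also have "\<dots> = hermite (n + 4) + smult (4 * real n + 10) (hermite (n + 2))
        + smult (4 * real (Suc (Suc n)) * real (Suc n)) (hermite n)"
    proof -
      have 1: "[:0, 2:] * hermite (Suc (n + 2)) = hermite (n + 4) + smult (2 * real (Suc (n + 2))) (hermite (n + 2))"
        using X_mult_hermite[of "n + 2"] by (simp only: add.assoc) simp
      have 2: "smult (2 * real (Suc (n + 2))) p + smult (2 * real (Suc (Suc n))) p = smult (4 * real n + 10) p" for p
        by (simp add: smult_add_left[symmetric] add.commute)
      show ?thesis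
        unfolding 1 X_mult_hermite smult_add_right smult_smult 2[symmetric]
        by (simp add: mult_ac numeral_eq_Suc del: hermite.simps of_nat_Suc)
    qed
    also have "4 * real n + 10 = d + 4 * s" by (simp add: s_def field_simps)
    finally show ?thesis
      unfolding f_def by (simp add: smult_add_left del: hermite.simps mult_pCons_left)
  qed
  have "f = smult 4 ([:sqrt s, 1:] * ([:- sqrt s, 1:] * hermite (n + 2)))"
  proof -
    have "[:sqrt s, 1:] * ([:- sqrt s, 1:] * hermite (n + 2)) = [:- s, 0, 1:] * hermite (n + 2)"
      using s unfolding mult.assoc[symmetric] by simp
    moreover have "[:0, 2:] * ([:0, 2:] * hermite (n + 2)) - smult (4 * s) (hermite (n + 2))
        = smult 4 ([:- s, 0, 1:] * hermite (n + 2))"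
      by (simp add: smult_diff_right del: hermite.simps add_2_eq_Suc')
    ultimately show ?thesis by (simp only: f_def add_2_eq_Suc')
  qed
  then have "real_rooted f"
    by (simp only:) (intro real_rooted_smult real_rooted_mult real_rooted_linear real_rooted_hermite)
  then have "real_rooted (hermite_op lam f)" using T unfolding hermite_multiplier_sequence_def by blast
  also have "hermite_op lam f = smult (d * lam (n + 2)) (hermite (n + 2) + smult c (hermite n))"
  proof -
    have "d * lam (n + 2) * c = 4 * real (Suc (Suc n)) * real (Suc n) * lam n"
    proof -
      have "c \<noteq> 0" "lam (n + 2) \<noteq> 0" using c(1) X pos by auto
      then show ?thesis by (simp add: d_def X_def)
    qed
    then show ?thesis
      unfolding f hermite_op_add hermite_op_smult hermite_op_hermite zero smult_add_right smult_smult
      by (simp add: mult_ac del: hermite.simps of_nat_Suc add_2_eq_Suc')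
  qed
  finally have "real_rooted (hermite (n + 2) + smult c (hermite n))" using d pos by simp
  moreover have "hermite_im (n + 2) 1 < c * hermite_im n 1"
    using c(2) im by (simp only: pos_divide_less_eq)
  ultimately show False using not_real_rooted_hermite_add[of 1] by auto
qed

lemma hermite_multiplier_sequence_mono:
  assumes T: "hermite_multiplier_sequence lam" and nontriv: "\<not> trivial_sequence lam"
    and nonneg: "\<And>n. lam n \<ge> 0"
  shows "lam n \<le> lam (Suc n)"
proof (rule ccontr)
  assume drop: "\<not> lam n \<le> lam (Suc n)"
  have rr: "jensen_real_rooted lam"
    by (intro multiplier_sequence_imp_jensen_real_rooted
        hermite_multiplier_sequence_imp_multiplier_sequence T)
  \<comment> \<open>Extends \<open>jensen_real_rooted_no_gap\<close> to a zero not adjacent to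
    \<open>a\<close>, via the first zero after \<open>a\<close>.\<close>
  have no_gap: "lam b = 0" if "lam a > 0" "lam a' = 0" "a < a'" "a' \<le> b" for a a' b
  proof -
    define m where "m = (LEAST k. a < k \<and> lam k = 0)"
    have m: "a < m" "lam m = 0" "m \<le> a'"
      using LeastI[of "\<lambda>k. a < k \<and> lam k = 0" a'] Least_le[of "\<lambda>k. a < k \<and> lam k = 0" a'] that
      by (auto simp: m_def)
    then obtain j where j: "m = Suc j" "a \<le> j" by (cases m) auto
    have "lam j > 0"
    proof (cases "j = a")
      case False
      then have "lam j \<noteq> 0"
        using not_less_Least[of j "\<lambda>k. a < k \<and> lam k = 0"] j by (auto simp: m_def)
      then show ?thesis using nonneg[of j] by simp
    qed (use that in simp)
    then show ?thesis
      using jensen_real_rooted_no_gap[OF rr nonneg, of j b] j m that by auto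
  qed
  have pos_n: "lam n > 0" using drop nonneg[of "Suc n"] by linarith
  show False
  proof (cases "\<forall>k\<ge>n. lam k > 0")
    case True
    have decr: "lam (Suc k) < lam k" if "n \<le> k" for k
      using that
    proof (induction k rule: dec_induct)
      case base
      then show ?case using drop by simp
    next
      case (step k)
      have p: "lam (Suc k) > 0" using True step by simp
      have "lam k * lam (Suc (Suc k)) \<le> lam (Suc k) * lam (Suc k)"
        using jensen_real_rooted_turan[OF rr, of k] by (simp add: power2_eq_square)
      also have "\<dots> < lam k * lam (Suc k)" using step p by simp
      finally show ?case using step p by (simp add: mult_less_cancel_left)
    qed
    \<comment> \<open>Any even index from \<open>n\<close> on would do.\<close>
    define m where "m = 2 * n"
    have "lam m \<le> lam (m + 2)"
      using True by (intro hermite_multiplier_even_step[OF T]) (auto simp: m_def)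
    moreover have "lam (m + 2) < lam m"
      using decr[of m] decr[of "Suc m"] by (simp add: m_def)
    ultimately show False by simp
  next
    case False
    then obtain j where j: "n \<le> j" "lam j = 0" using nonneg by (meson less_le not_less)
    have "n < j" using j pos_n by (cases "n = j") auto
    \<comment> \<open>The last index of the support. Non-triviality and the absence of gaps make
      \<open>lam (N - 2)\<close> positive, which \<open>hermite_multiplier_no_cutoff\<close> forbids
      as \<open>lam (N + 2) = 0\<close>.\<close>
    define N where "N = (GREATEST k. lam k > 0)"
    have bound: "k \<le> j" if "lam k > 0" for k
      using no_gap[OF pos_n j(2) \<open>n < j\<close>, of k] that by force
    have N: "lam N > 0" unfolding N_def by (rule GreatestI_nat[of _ n j]) (use pos_n bound in auto)
    have above: "lam k = 0" if "k > N" for k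
    proof (rule ccontr)
      assume "lam k \<noteq> 0"
      then have "lam k > 0" using nonneg[of k] by simp
      then have "k \<le> N" unfolding N_def by (intro Greatest_le_nat[of _ k j]) (use bound in auto)
      then show False using that by simp
    qed
    have "\<exists>k. k + 2 \<le> N \<and> lam k > 0"
    proof (rule ccontr)
      assume *: "\<not> ?thesis"
      \<comment> \<open>For \<open>N = 0\<close> truncated subtraction yields the pair
        \<open>0, 1\<close>, which still contains the support.\<close>
      have "lam k = 0" if "k \<noteq> N - 1 \<and> k \<noteq> Suc (N - 1)" for k
      proof (cases "k > N")
        case False
        then have "k + 2 \<le> N" using that by linarith
        then show ?thesis using * nonneg[of k] by (force simp: less_le)
      qed (use above in simp)
      then have "trivial_sequence lam" unfolding trivial_sequence_def by blast
      then show False using nontriv by simp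
    qed
    then obtain k where k: "k + 2 \<le> N" "lam k > 0" by blast
    define i where "i = N - 2"
    have i: "N = i + 2" "k \<le> i" using k by (auto simp: i_def)
    have "lam i > 0"
    proof (rule ccontr)
      assume "\<not> lam i > 0"
      then have "lam i = 0" using nonneg[of i] by simp
      moreover from this have "k < i" using k i by (cases "k = i") auto
      ultimately have "lam N = 0" using no_gap[OF k(2)] i by auto
      then show False using N by simp
    qed
    then have "lam (i + 4) \<noteq> 0" using hermite_multiplier_no_cutoff[OF T] N i by simp
    then show False using above[of "i + 4"] i by simp
  qed
qed

theorem theorem3p1:
  fixes lam :: "nat \<Rightarrow> real"
  assumes "\<not> trivial_sequence lam"
    and "\<And>n. lam n \<ge> 0"
  shows "hermite_multiplier_sequence lam \<longleftrightarrow>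
           multiplier_sequence lam \<and> (\<forall>n. lam n \<le> lam (Suc n))"
  using hermite_multiplier_sequence_imp_multiplier_sequence hermite_multiplier_sequence_mono assms
    multiplier_sequence_imp_jensen_real_rooted hermite_multiplier_sequenceI
  by blast

end
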